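(* Let $G$ be a finite simple graph with chromatic number exactly $4$ and with no connected component isomorphic to $K_2$. Then $G$ admits a p-proper $3$-labelling, i.e., $\chi_{\rm P}(G) \leq 3$.
   Context: A $k$-labelling of a graph $G$ is a map $\ell: E(G) \to \{1,\dots,k\}$. For a vertex $v$, $\rho_\ell(v)$ denotes the product of the labels $\ell(uv)$ over all edges $uv$ incident to $v$ (the empty product being $1$). The labelling $\ell$ is p-proper if $\rho_\ell(u) \neq \rho_\ell(v)$ for every edge $uv$ of $G$. $\chi_{\rm P}(G)$ is the least $k \geq 1$ such that $G$ admits a p-proper $k$-labelling. *)

theory Defs
  imports Complex_Main "HOL-Library.FuncSet" "HOL-Library.Extended_Nat"
begin

record 'a ugraph =
  verts :: "'a set"
  edges :: "'a set set"

definition finite_simple_graph :: "'a ugraph \<Rightarrow> bool" where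
  "finite_simple_graph G \<longleftrightarrow>
     finite (verts G) \<and> edges G \<subseteq> {e. e \<subseteq> verts G \<and> card e = 2}"

definition adj_rel :: "'a ugraph \<Rightarrow> ('a \<times> 'a) set" where
  "adj_rel G = {(u, v). {u, v} \<in> edges G}"

definition induced_subgraph :: "'a ugraph \<Rightarrow> 'a set \<Rightarrow> 'a ugraph" where
  "induced_subgraph G W = \<lparr>verts = W, edges = {e \<in> edges G. e \<subseteq> W}\<rparr>"

definition connected_components :: "'a ugraph \<Rightarrow> 'a ugraph set" where
  "connected_components G =
     (\<lambda>v. induced_subgraph G {u \<in> verts G. (v, u) \<in> (adj_rel G)\<^sup>*}) ` verts G"

definition graph_isomorphic :: "'a ugraph \<Rightarrow> 'b ugraph \<Rightarrow> bool" where
  "graph_isomorphic G H \<longleftrightarrow>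
     (\<exists>f. bij_betw f (verts G) (verts H) \<and>
       (\<forall>u\<in>verts G. \<forall>v\<in>verts G. {u, v} \<in> edges G \<longleftrightarrow> {f u, f v} \<in> edges H))"

definition complete_graph :: "nat \<Rightarrow> nat ugraph" where
  "complete_graph n = \<lparr>verts = {..<n}, edges = {e. e \<subseteq> {..<n} \<and> card e = 2}\<rparr>"

definition proper_colouring :: "'a ugraph \<Rightarrow> nat \<Rightarrow> ('a \<Rightarrow> nat) \<Rightarrow> bool" where
  "proper_colouring G k c \<longleftrightarrow>
     c \<in> verts G \<rightarrow> {1..k} \<and> (\<forall>u v. {u, v} \<in> edges G \<longrightarrow> c u \<noteq> c v)"

text \<open>For a finite simple graph some proper colouring exists, so the \<^term>\<open>Least\<close> below is attained.\<close>

definition chromatic_number :: "'a ugraph \<Rightarrow> nat" where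
  "chromatic_number G = (LEAST k. \<exists>c. proper_colouring G k c)"

definition labelling :: "'a ugraph \<Rightarrow> nat \<Rightarrow> ('a set \<Rightarrow> nat) \<Rightarrow> bool" where
  "labelling G k l \<longleftrightarrow> l \<in> edges G \<rightarrow> {1..k}"

definition label_product :: "'a ugraph \<Rightarrow> ('a set \<Rightarrow> nat) \<Rightarrow> 'a \<Rightarrow> nat" where
  "label_product G l v = (\<Prod>e \<in> {e \<in> edges G. v \<in> e}. l e)"

definition p_proper :: "'a ugraph \<Rightarrow> ('a set \<Rightarrow> nat) \<Rightarrow> bool" where
  "p_proper G l \<longleftrightarrow>
     (\<forall>u v. {u, v} \<in> edges G \<longrightarrow> label_product G l u \<noteq> label_product G l v)"

text \<open>The value is \<open>\<infinity>\<close> when no p-proper labelling exists, as for a graph with a component \<open>K\<^sub>2\<close>.\<close>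

definition chi_P :: "'a ugraph \<Rightarrow> enat" where
  "chi_P G = Inf {enat k | k. k \<ge> 1 \<and> (\<exists>l. labelling G k l \<and> p_proper G l)}"

end

theory Submission
  imports Defs
begin

text \<open>
  Let \<open>A\<close> and \<open>B\<close> be the sets of edges labelled 2 and 3. The product at \<open>v\<close> is \<open>2 ^ a v * 3 ^ b v\<close>
  with \<open>a v = deg A v\<close>, \<open>b v = deg B v\<close>, so the pairs \<open>(a v, b v)\<close> must differ along edges.

  Take a proper 4-colouring that first minimises the number of edges inside the set \<open>W\<close> of
  vertices of colours 3 and 4, and then \<open>|W|\<close>. By minimality every \<open>w \<in> W\<close> has neighbours of
  colours 1 and 2. Label edges from \<open>W\<close> to colour 1 by 2 and from \<open>W\<close> to colour 2 by 3, so that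
  \<open>a\<close> and \<open>b\<close> are both positive on \<open>W\<close> and exactly one of them is positive on the remaining
  vertices with a neighbour in \<open>W\<close>. Inside \<open>W\<close> the parity of \<open>a\<close> separates colours 3 and 4: labels
  1 and 2 along a spanning tree correct all vertices of a component but one root, and the root is
  corrected by changing one of its edges to colour 1 from label 2 to label 1. Since the number
  of edges inside \<open>W\<close> is minimal, the roots and these edges can be chosen so that no vertex of colour 1
  loses all its edges labelled 2.

  There remain the vertices with no neighbour in \<open>W\<close>. They are handled by the same parity argument,
  with label 2 or label 3, and the wrong parity at a root is compensated by one edge that gives the
  root both labels; nothing in \<open>W\<close> is adjacent to it. A component of the graph that does not meet \<open>W\<close>
  is bipartite; there a vertex with two incident edges labelled 3 absorbs the parity.
\<close>

section \<open>Degrees and parities in edge sets\<close>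

definition deg :: "'a set set \<Rightarrow> 'a \<Rightarrow> nat" where
  "deg A v = card {e \<in> A. v \<in> e}"

text \<open>Takes a bare edge set, because most walks below are confined to a subset of the edges of
  the graph.\<close>

definition adj_in :: "'a set set \<Rightarrow> ('a \<times> 'a) set" where
  "adj_in H = {(u, v). {u, v} \<in> H}"

definition distinguishing :: "'a set set \<Rightarrow> 'a set set \<Rightarrow> 'a set set \<Rightarrow> bool" where
  "distinguishing E A B \<longleftrightarrow> A \<subseteq> E \<and> B \<subseteq> E \<and> A \<inter> B = {} \<and>
     (\<forall>u v. {u, v} \<in> E \<longrightarrow> deg A u \<noteq> deg A v \<or> deg B u \<noteq> deg B v)"

lemma adj_in_iff [simp]: "(u, v) \<in> adj_in H \<longleftrightarrow> {u, v} \<in> H"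
  by (simp add: adj_in_def)

lemma adj_in_sym: "(u, v) \<in> (adj_in H)\<^sup>* \<Longrightarrow> (v, u) \<in> (adj_in H)\<^sup>*"
  using sym_rtrancl[of "adj_in H"] by (simp add: sym_def insert_commute)

lemma card2_obtain:
  assumes "card e = 2" "v \<in> e"
  obtains u where "e = {v, u}" "u \<noteq> v"
proof -
  from assms(1) obtain x y where xy: "e = {x, y}" "x \<noteq> y" by (auto simp: card_2_iff)
  show thesis
  proof (cases "v = x")
    case True then show ?thesis using that[of y] xy by auto
  next
    case False then show ?thesis using that[of x] xy assms(2) by auto
  qed
qed

lemma deg_cong:
  assumes "\<And>e. v \<in> e \<Longrightarrow> e \<in> A \<longleftrightarrow> e \<in> B"
  shows "deg A v = deg B v"
proof -
  have "{e \<in> A. v \<in> e} = {e \<in> B. v \<in> e}" using assms by blast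
  then show ?thesis by (simp add: deg_def)
qed

lemma deg_Un:
  assumes "finite A" "finite B" "A \<inter> B = {}"
  shows "deg (A \<union> B) v = deg A v + deg B v"
proof -
  have "{e \<in> A \<union> B. v \<in> e} = {e \<in> A. v \<in> e} \<union> {e \<in> B. v \<in> e}" by auto
  moreover have "card ({e \<in> A. v \<in> e} \<union> {e \<in> B. v \<in> e}) = card {e \<in> A. v \<in> e} + card {e \<in> B. v \<in> e}"
    using assms by (intro card_Un_disjoint) auto
  ultimately show ?thesis by (simp add: deg_def)
qed

lemma deg_eq_0:
  assumes "\<And>e. e \<in> A \<Longrightarrow> v \<notin> e"
  shows "deg A v = 0"
proof -
  have "{e \<in> A. v \<in> e} = {}" using assms by blast
  then show ?thesis by (simp only: deg_def card.empty)
qed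

lemma deg_eq_1: "e \<in> A \<Longrightarrow> v \<in> e \<Longrightarrow> (\<And>f. f \<in> A \<Longrightarrow> v \<in> f \<Longrightarrow> f = e) \<Longrightarrow> deg A v = 1"
proof -
  assume a: "e \<in> A" "v \<in> e" "\<And>f. f \<in> A \<Longrightarrow> v \<in> f \<Longrightarrow> f = e"
  have "{f \<in> A. v \<in> f} = {e}" using a by blast
  then show ?thesis by (simp add: deg_def)
qed

lemma deg_pos: "finite A \<Longrightarrow> e \<in> A \<Longrightarrow> v \<in> e \<Longrightarrow> deg A v > 0"
  unfolding deg_def by (auto simp: card_gt_0_iff)

lemma deg_remove:
  assumes "finite A" "e \<in> A" "v \<in> e"
  shows "deg A v = Suc (deg (A - {e}) v)"
proof -
  have "{f \<in> A. v \<in> f} = insert e {f \<in> A - {e}. v \<in> f}" using assms by auto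
  then show ?thesis unfolding deg_def using assms by simp
qed

text \<open>Common edges are counted in both degrees and cancel modulo 2, so symmetric difference
  adds degree parities. This allows edge sets to be corrected along paths.\<close>

lemma odd_deg_sym_diff:
  assumes "finite A" "finite B"
  shows "odd (deg ((A - B) \<union> (B - A)) v) \<longleftrightarrow> odd (deg A v) \<noteq> odd (deg B v)"
proof -
  have 1: "deg ((A - B) \<union> (B - A)) v = deg (A - B) v + deg (B - A) v"
    using assms by (intro deg_Un) auto
  have "deg ((A - B) \<union> (A \<inter> B)) v = deg (A - B) v + deg (A \<inter> B) v"
    using assms by (intro deg_Un) auto
  moreover have "(A - B) \<union> (A \<inter> B) = A" by auto
  ultimately have 2: "deg A v = deg (A - B) v + deg (A \<inter> B) v" by simp
  have "deg ((B - A) \<union> (A \<inter> B)) v = deg (B - A) v + deg (A \<inter> B) v"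
    using assms by (intro deg_Un) auto
  moreover have "(B - A) \<union> (A \<inter> B) = B" by auto
  ultimately have 3: "deg B v = deg (B - A) v + deg (A \<inter> B) v" by simp
  show ?thesis unfolding 1 2 3 by auto
qed

text \<open>\<open>J\<close> is the modulo 2 sum of the edges of a walk from \<open>x\<close> to
  \<open>y\<close>, in which the contributions at inner vertices cancel. The condition is an
  exclusive or: for \<open>x = y\<close> all degrees are even.\<close>

lemma path_parity:
  assumes "(x, y) \<in> (adj_in H)\<^sup>*" "finite H" "\<And>e. e \<in> H \<Longrightarrow> card e = 2"
  shows "\<exists>J\<subseteq>H. \<forall>v. odd (deg J v) \<longleftrightarrow> (v = x) \<noteq> (v = y)"
  using assms(1)
proof (induction rule: converse_rtrancl_induct)
  case base
  show ?case by (rule exI[of _ "{}"]) (simp add: deg_def)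
next
  case (step x z)
  from step.IH obtain J where J: "J \<subseteq> H" "\<And>v. odd (deg J v) \<longleftrightarrow> (v = z) \<noteq> (v = y)" by blast
  have e: "{x, z} \<in> H" using step.hyps by simp
  then have "x \<noteq> z" using assms(3)[OF e] by auto
  have d: "odd (deg {{x, z}} v) \<longleftrightarrow> (v = x) \<noteq> (v = z)" for v
  proof (cases "v \<in> {x, z}")
    case True
    then have "deg {{x, z}} v = 1" by (intro deg_eq_1) auto
    then show ?thesis using True \<open>x \<noteq> z\<close> by auto
  next
    case False
    then have "deg {{x, z}} v = 0" by (intro deg_eq_0) auto
    then show ?thesis using False by auto
  qed
  have f: "finite J" using J(1) assms(2) finite_subset by blast
  have "odd (deg ((J - {{x, z}}) \<union> ({{x, z}} - J)) v) \<longleftrightarrow> (v = x) \<noteq> (v = y)" for v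
    using odd_deg_sym_diff[OF f, of "{{x, z}}" v] d[of v] J(2)[of v] by auto
  then show ?case using J(1) e by (intro exI[of _ "(J - {{x, z}}) \<union> ({{x, z}} - J)"]) auto
qed

text \<open>Adding modulo 2 a path from a vertex to \<open>R\<close> flips, outside
  \<open>R\<close>, the parity at that vertex only. The parities at the roots \<open>R\<close> stay
  uncontrolled.\<close>

lemma parity_subset:
  assumes "finite H" "\<And>e. e \<in> H \<Longrightarrow> card e = 2" "finite S"
    and reach: "\<And>v. v \<in> S \<Longrightarrow> \<exists>r\<in>R. (v, r) \<in> (adj_in H)\<^sup>*"
  shows "\<exists>J\<subseteq>H. \<forall>v\<in>S - R. odd (deg J v) \<longleftrightarrow> t v"
proof -
  have "\<exists>J\<subseteq>H. \<forall>v\<in>S - R. odd (deg J v) \<longleftrightarrow> v \<in> X" if "X \<subseteq> S - R" for X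
    using finite_subset[OF that finite_Diff[OF assms(3)]] that
  proof (induction X rule: finite_induct)
    case empty
    show ?case by (rule exI[of _ "{}"]) (simp add: deg_def)
  next
    case (insert x X)
    then obtain J where J: "J \<subseteq> H" "\<And>v. v \<in> S - R \<Longrightarrow> odd (deg J v) \<longleftrightarrow> v \<in> X" by blast
    obtain r where r: "r \<in> R" "(x, r) \<in> (adj_in H)\<^sup>*" using reach insert.prems by auto
    obtain P where P: "P \<subseteq> H" "\<And>v. odd (deg P v) \<longleftrightarrow> (v = x) \<noteq> (v = r)"
      using path_parity[OF r(2) assms(1,2)] by blast
    have "finite J" "finite P" using J(1) P(1) assms(1) finite_subset by blast+
    then have "odd (deg ((J - P) \<union> (P - J)) v) \<longleftrightarrow> v \<in> insert x X" if "v \<in> S - R" for v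
      using odd_deg_sym_diff[of J P v] J(2)[OF that] P(2)[of v] that r(1) insert.hyps by auto
    then show ?case using J(1) P(1) by (intro exI[of _ "(J - P) \<union> (P - J)"]) auto
  qed
  from this[of "{v \<in> S - R. t v}"] show ?thesis by auto
qed

section \<open>Choosing one spared edge per class\<close>

text \<open>
  A selected edge \<open>(w, x)\<close> is spared if another edge at \<open>x\<close> is never selected. Selections are made one
  at a time so that at most one selected edge is not yet spared; the next class to select is the
  one that can spare it.
\<close>
lemma spare_choice:
  fixes cl :: "'w \<Rightarrow> 'd" and P :: "'w \<Rightarrow> 'x \<Rightarrow> bool"
  assumes fin: "finite \<D>"
    and cand: "\<And>D. D \<in> \<D> \<Longrightarrow> \<exists>w x w' x'. cl w = D \<and> cl w' = D \<and> w \<noteq> w' \<and> P w x \<and> P w' x' \<and>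
                 (\<exists>v. v \<noteq> w \<and> P v x) \<and> (\<exists>v. v \<noteq> w' \<and> P v x')"
  shows "\<exists>g. \<forall>D\<in>\<D>. cl (fst (g D)) = D \<and> P (fst (g D)) (snd (g D)) \<and>
           (\<exists>v. P v (snd (g D)) \<and> (v, snd (g D)) \<notin> g ` \<D>)"
proof -
  define ok where "ok D p \<longleftrightarrow> cl (fst p) = D \<and> P (fst p) (snd p) \<and> (\<exists>v. v \<noteq> fst p \<and> P v (snd p))" for D p
  \<comment> \<open>The sparing edge must belong to a class already treated or outside
    \<open>\<D>\<close>, so that no later selection can take it. The notion depends on a selected
    pair only through its \<open>x\<close>.\<close>
  define safe where "safe A g x \<longleftrightarrow> (\<exists>v. P v x \<and> (cl v \<in> A \<or> cl v \<notin> \<D>) \<and> (v, x) \<notin> g ` A)"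
    for A and g :: "'d \<Rightarrow> 'w \<times> 'x" and x
  have two: "\<exists>p. ok D p \<and> p \<noteq> q" if "D \<in> \<D>" for D q
  proof -
    from cand[OF that] obtain w x w' x' where
      "cl w = D \<and> cl w' = D \<and> w \<noteq> w' \<and> P w x \<and> P w' x' \<and>
       (\<exists>v. v \<noteq> w \<and> P v x) \<and> (\<exists>v. v \<noteq> w' \<and> P v x')" by blast
    then have "ok D (w, x)" "ok D (w', x')" "(w, x) \<noteq> (w', x')" by (auto simp: ok_def)
    then show ?thesis by metis
  qed
  \<comment> \<open>Invariant after \<open>n\<close> selections: all treated classes, except
    possibly the latest one \<open>D0\<close>, are spared for good.\<close>
  have "\<exists>A g D0. A \<subseteq> \<D> \<and> card A = n \<and> (\<forall>D\<in>A. ok D (g D)) \<and>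
          (\<forall>D\<in>A. D = D0 \<or> safe A g (snd (g D)))" if "n \<le> card \<D>" for n
    using that
  proof (induction n)
    case 0
    show ?case by (rule exI[of _ "{}"]) auto
  next
    case (Suc n)
    then obtain A g D0 where A: "A \<subseteq> \<D>" "card A = n" and ok: "\<And>D. D \<in> A \<Longrightarrow> ok D (g D)"
      and s: "\<And>D. D \<in> A \<Longrightarrow> D = D0 \<or> safe A g (snd (g D))"
      by (metis Suc_leD)
    have fA: "finite A" using A fin finite_subset by blast
    have "\<exists>D'\<in>\<D> - A. \<exists>p. ok D' p \<and>
            (\<forall>D\<in>A. safe A g (snd (g D)) \<or>
               (\<exists>v. P v (snd (g D)) \<and> cl v = D' \<and> (v, snd (g D)) \<notin> insert p (g ` A)))"
    proof (cases "\<forall>D\<in>A. safe A g (snd (g D))")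
      case True
      have "\<D> - A \<noteq> {}" using Suc.prems A fin by (metis card_mono Diff_eq_empty_iff fA not_less_eq_eq)
      then obtain D' where "D' \<in> \<D> - A" by blast
      then show ?thesis using True two by blast
    next
      case False
      then have D0: "D0 \<in> A" "\<not> safe A g (snd (g D0))" using s by auto
      obtain v where v: "v \<noteq> fst (g D0)" "P v (snd (g D0))" using ok[OF D0(1)] by (auto simp: ok_def)
      \<comment> \<open>A class other than \<open>D0\<close> that had selected this edge would be
        safe with the same \<open>x\<close>, making \<open>D0\<close> safe. So the edge is
        unselected, and it fails to spare \<open>D0\<close> only because its class is untreated;
        that class comes next.\<close>
      have nin: "(v, snd (g D0)) \<notin> g ` A"
      proof
        assume "(v, snd (g D0)) \<in> g ` A"
        then obtain D where D: "D \<in> A" "g D = (v, snd (g D0))" by (metis imageE)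
        then have "D \<noteq> D0" using v(1) by (metis fst_conv)
        then have "safe A g (snd (g D))" using s D(1) by blast
        then show False using D0 D by simp
      qed
      then have cl: "cl v \<in> \<D> - A" using D0(2) v(2) unfolding safe_def by blast
      \<comment> \<open>Each class offers two candidates, so one avoids the edge that is to spare
        \<open>D0\<close>.\<close>
      obtain p where p: "ok (cl v) p" "p \<noteq> (v, snd (g D0))" using two cl by blast
      have "\<forall>D\<in>A. safe A g (snd (g D)) \<or>
               (\<exists>u. P u (snd (g D)) \<and> cl u = cl v \<and> (u, snd (g D)) \<notin> insert p (g ` A))"
        using s nin p(2) v(2) by blast
      then show ?thesis using cl p(1) by blast
    qed
    then obtain D' p where D': "D' \<in> \<D>" "D' \<notin> A" and p: "ok D' p"
      and sp: "\<And>D. D \<in> A \<Longrightarrow> safe A g (snd (g D)) \<or>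
               (\<exists>v. P v (snd (g D)) \<and> cl v = D' \<and> (v, snd (g D)) \<notin> insert p (g ` A))"
      by blast
    define g' where "g' = g(D' := p)"
    have im: "g' ` insert D' A = insert p (g ` A)" using D'(2) by (auto simp: g'_def)
    have gA: "D \<in> A \<Longrightarrow> g' D = g D" for D using D'(2) by (auto simp: g'_def)
    have "safe (insert D' A) g' (snd (g' D))" if "D \<in> A" for D
      using sp[OF that]
    proof
      assume "safe A g (snd (g D))"
      then obtain v where v: "P v (snd (g D))" "cl v \<in> A \<or> cl v \<notin> \<D>" "(v, snd (g D)) \<notin> g ` A"
        unfolding safe_def by blast
      have "cl v \<noteq> D'" using v(2) D' by auto
      then have "(v, snd (g D)) \<noteq> p" using p by (auto simp: ok_def)
      then show ?thesis unfolding safe_def im gA[OF that] using v by blast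
    next
      assume "\<exists>v. P v (snd (g D)) \<and> cl v = D' \<and> (v, snd (g D)) \<notin> insert p (g ` A)"
      then show ?thesis unfolding safe_def im gA[OF that] by blast
    qed
    moreover have "\<forall>D\<in>insert D' A. ok D (g' D)" using ok p gA by (auto simp: g'_def)
    moreover have "card (insert D' A) = Suc n" using A fA D' by simp
    ultimately show ?case using A(1) D'(1)
      by (intro exI[of _ "insert D' A"] exI[of _ g'] exI[of _ D']) auto
  qed
  from this[OF order_refl] obtain A g D0 where "A \<subseteq> \<D>" "card A = card \<D>"
    and ok: "\<forall>D\<in>A. ok D (g D)" and s: "\<forall>D\<in>A. D = D0 \<or> safe A g (snd (g D))" by blast
  then have [simp]: "A = \<D>" using fin card_subset_eq by blast
  \<comment> \<open>Once all classes are treated the class condition in \<open>safe\<close> is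
    vacuous, and the argument used for \<open>nin\<close> settles \<open>D0\<close> as well.\<close>
  have "\<exists>v. P v (snd (g D)) \<and> (v, snd (g D)) \<notin> g ` \<D>" if D: "D \<in> \<D>" for D
  proof (cases "safe \<D> g (snd (g D))")
    case True
    then show ?thesis unfolding safe_def by blast
  next
    case False
    then have "D = D0" using s D by auto
    obtain v where v: "v \<noteq> fst (g D)" "P v (snd (g D))" using ok D by (auto simp: ok_def)
    have "(v, snd (g D)) \<notin> g ` \<D>"
    proof
      assume "(v, snd (g D)) \<in> g ` \<D>"
      then obtain D1 where D1: "D1 \<in> \<D>" "g D1 = (v, snd (g D))" by (metis imageE)
      then have "D1 \<noteq> D" using v(1) by (metis fst_conv)
      then have "safe \<D> g (snd (g D1))" using s D1(1) \<open>D = D0\<close> \<open>A = \<D>\<close> by blast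
      then show False using False D1 by simp
    qed
    then show ?thesis using v by blast
  qed
  then show ?thesis using ok by (auto simp: ok_def)
qed

section \<open>Connected bipartite graphs\<close>

text \<open>Parity of the 2-degree separates the two sides except at the root \<open>r\<close>. Two
  3-edges at \<open>r\<close> give 3-degree 2 at \<open>r\<close>, 1 at \<open>s1\<close> and
  \<open>s2\<close>, and 0 elsewhere; since \<open>s1\<close> and \<open>s2\<close> lie on the same
  side, this separates every edge meeting one of the three.\<close>

lemma bipartite_distinguishing:
  assumes "finite E" "\<And>e. e \<in> E \<Longrightarrow> card e = 2"
    and conn: "\<And>u v. u \<in> \<Union>E \<Longrightarrow> v \<in> \<Union>E \<Longrightarrow> (u, v) \<in> (adj_in E)\<^sup>*"
    and proper: "\<And>u v. {u, v} \<in> E \<Longrightarrow> (p u :: bool) \<noteq> p v"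
    and r: "{r, s1} \<in> E" "{r, s2} \<in> E" "s1 \<noteq> s2"
  shows "\<exists>A B. distinguishing E A B"
proof -
  have fU: "finite (\<Union>E)" using assms(1,2) by (metis card.infinite finite_Union zero_neq_numeral)
  have "\<exists>J\<subseteq>E. \<forall>v\<in>\<Union>E - {r}. odd (deg J v) \<longleftrightarrow> p v"
    using conn r(1) by (intro parity_subset assms(1,2) fU) blast+
  then obtain J where J: "J \<subseteq> E" "\<And>v. v \<in> \<Union>E \<Longrightarrow> v \<noteq> r \<Longrightarrow> odd (deg J v) \<longleftrightarrow> p v" by blast
  define B where "B = {{r, s1}, {r, s2}}"
  have rs: "r \<noteq> s1" "r \<noteq> s2" using proper r by auto
  have ne: "{r, s1} \<noteq> {r, s2}" using r(3) by (auto simp: doubleton_eq_iff)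
  have Br: "deg B r = 2"
  proof -
    have "{e \<in> B. r \<in> e} = {{r, s1}, {r, s2}}" by (auto simp: B_def)
    then show ?thesis using ne by (simp add: deg_def)
  qed
  have Bs: "deg B s = 1" if "s = s1 \<or> s = s2" for s
    using that rs r(3) by (intro deg_eq_1[of "{r, s}"]) (auto simp: B_def)
  have B0: "deg B v = 0" if "v \<notin> {r, s1, s2}" for v using that by (intro deg_eq_0) (auto simp: B_def)
  \<comment> \<open>Removing \<open>B\<close> from \<open>J\<close> can spoil the parity only at
    \<open>r\<close>, \<open>s1\<close> and \<open>s2\<close>, where it is not relied on.\<close>
  have A0: "deg (J - B) v = deg J v" if "v \<notin> {r, s1, s2}" for v
    using that by (intro deg_cong) (auto simp: B_def)
  have pr: "p s1 = (\<not> p r)" "p s2 = (\<not> p r)" using proper[OF r(1)] proper[OF r(2)] by auto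
  have "deg (J - B) u \<noteq> deg (J - B) v \<or> deg B u \<noteq> deg B v" if e: "{u, v} \<in> E" for u v
  proof (cases "u \<in> {r, s1, s2} \<or> v \<in> {r, s1, s2}")
    case False
    then have "deg (J - B) u = deg J u" "deg (J - B) v = deg J v" using A0 by auto
    moreover have "odd (deg J u) \<noteq> odd (deg J v)" using J(2)[of u] J(2)[of v] e False proper[OF e] by auto
    ultimately show ?thesis by auto
  next
    case True
    have "p u \<noteq> p v" using proper e by blast
    moreover have "deg B v = (if v = r then 2 else if v = s1 \<or> v = s2 then 1 else 0)" for v
      using Br Bs B0 by auto
    ultimately have "deg B u \<noteq> deg B v" using True pr by auto
    then show ?thesis by simp
  qed
  then have "distinguishing E (J - B) B" unfolding distinguishing_def using J(1) r by (auto simp: B_def)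
  then show ?thesis by blast
qed

section \<open>Reduced colourings and the 2-edges at colours 3 and 4\<close>

text \<open>Records what minimality provides, with \<open>3 \<le> c w\<close> expressing membership
  in \<open>W\<close>. By \<open>spare\<close>, the edge \<open>{w, x}\<close> can give up label 2
  while \<open>x\<close> keeps another neighbour in \<open>W\<close>. It applies to both ends of an
  edge inside \<open>W\<close>, which yields the two candidates required by
  \<open>spare_choice\<close>.\<close>

locale reduced_colouring =
  fixes E :: "'a set set" and c :: "'a \<Rightarrow> nat"
  assumes fin: "finite E"
    and card2: "e \<in> E \<Longrightarrow> card e = 2"
    and proper: "{u, v} \<in> E \<Longrightarrow> c u \<noteq> c v"
    and colours: "v \<in> \<Union>E \<Longrightarrow> 1 \<le> c v \<and> c v \<le> 4"
    and down: "w \<in> \<Union>E \<Longrightarrow> 3 \<le> c w \<Longrightarrow> i = 1 \<or> i = 2 \<Longrightarrow> \<exists>x. {w, x} \<in> E \<and> c x = i"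
    and spare: "{w, w'} \<in> E \<Longrightarrow> 3 \<le> c w \<Longrightarrow> 3 \<le> c w' \<Longrightarrow>
      \<exists>x v. {w, x} \<in> E \<and> c x = 1 \<and> {v, x} \<in> E \<and> 3 \<le> c v \<and> v \<noteq> w"
begin

lemma fin_verts: "finite (\<Union>E)"
  using fin card2 by (metis card.infinite finite_Union zero_neq_numeral)

lemma edge_ends:
  assumes "{u, v} \<in> E"
  shows "u \<in> \<Union>E" "v \<in> \<Union>E"
  using assms by auto

text \<open>All edges between \<open>W\<close> and colour 1 start in \<open>A\<close>. Parities are
  then adjusted by edges inside each component of \<open>W\<close>, and at most one edge per
  component is withdrawn, at its root.\<close>

lemma upper_edges:
  obtains A where "A \<subseteq> {e \<in> E. \<exists>u w. e = {u, w} \<and> 3 \<le> c w \<and> (c u = 1 \<or> 3 \<le> c u)}"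
    and "\<And>w. w \<in> \<Union>E \<Longrightarrow> 3 \<le> c w \<Longrightarrow> deg A w > 0"
    and "\<And>w w'. {w, w'} \<in> E \<Longrightarrow> 3 \<le> c w \<Longrightarrow> 3 \<le> c w' \<Longrightarrow> deg A w \<noteq> deg A w'"
    and "\<And>u w. {u, w} \<in> E \<Longrightarrow> c u = 1 \<Longrightarrow> 3 \<le> c w \<Longrightarrow> deg A u > 0"
proof -
  define F where "F = {e \<in> E. \<forall>w\<in>e. 3 \<le> c w}"
  define cl where "cl w = (adj_in F)\<^sup>* `` {w}" for w
  \<comment> \<open>Only components of \<open>W\<close> with an edge need a root; elsewhere in
    \<open>W\<close> there is nothing to separate.\<close>
  define \<D> where "\<D> = cl ` \<Union>F"
  define P where "P w x \<longleftrightarrow> {w, x} \<in> E \<and> 3 \<le> c w \<and> c x = 1" for w x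
  have finF: "finite F" and cardF: "\<And>e. e \<in> F \<Longrightarrow> card e = 2"
    using fin card2 by (auto simp: F_def)
  have finUF: "finite (\<Union>F)" using fin_verts by (rule rev_finite_subset) (auto simp: F_def)
  have cl_adj: "cl w = cl w'" if "{w, w'} \<in> F" for w w'
  proof -
    have "(w, w') \<in> (adj_in F)\<^sup>*" "(w', w) \<in> (adj_in F)\<^sup>*"
      using that by (auto simp: insert_commute)
    then show ?thesis unfolding cl_def by (auto intro: rtrancl_trans)
  qed
  have "\<exists>g. \<forall>D\<in>\<D>. cl (fst (g D)) = D \<and> P (fst (g D)) (snd (g D)) \<and>
           (\<exists>v. P v (snd (g D)) \<and> (v, snd (g D)) \<notin> g ` \<D>)"
  proof (rule spare_choice)
    show "finite \<D>" unfolding \<D>_def using finUF by simp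
  next
    fix D assume "D \<in> \<D>"
    then obtain w e where w: "w \<in> e" "e \<in> F" "cl w = D" by (auto simp: \<D>_def)
    obtain w' where w': "e = {w, w'}" "w' \<noteq> w" using card2_obtain[OF cardF[OF w(2)] w(1)] .
    have e: "{w, w'} \<in> E" "{w', w} \<in> E" "3 \<le> c w" "3 \<le> c w'"
      using w w' by (auto simp: F_def insert_commute)
    obtain x v where x: "{w, x} \<in> E \<and> c x = 1 \<and> {v, x} \<in> E \<and> 3 \<le> c v \<and> v \<noteq> w"
      using spare[OF e(1,3,4)] by blast
    obtain x' v' where x': "{w', x'} \<in> E \<and> c x' = 1 \<and> {v', x'} \<in> E \<and> 3 \<le> c v' \<and> v' \<noteq> w'"
      using spare[OF e(2,4,3)] by blast
    show "\<exists>w x w' x'. cl w = D \<and> cl w' = D \<and> w \<noteq> w' \<and> P w x \<and> P w' x' \<and>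
                 (\<exists>v. v \<noteq> w \<and> P v x) \<and> (\<exists>v. v \<noteq> w' \<and> P v x')"
    proof (intro exI conjI)
      show "cl w = D" "cl w' = D" using w w' cl_adj by auto
      show "w \<noteq> w'" using w' by simp
      show "P w x" "P w' x'" "v \<noteq> w" "P v x" "v' \<noteq> w'" "P v' x'"
        using x x' e by (auto simp: P_def)
    qed
  qed
  then obtain g where g: "\<And>D. D \<in> \<D> \<Longrightarrow> cl (fst (g D)) = D"
    "\<And>D. D \<in> \<D> \<Longrightarrow> P (fst (g D)) (snd (g D))"
    "\<And>D. D \<in> \<D> \<Longrightarrow> \<exists>v. P v (snd (g D)) \<and> (v, snd (g D)) \<notin> g ` \<D>" by blast
  define rt where "rt w = fst (g (cl w))" for w
  define R where "R = (\<lambda>D. fst (g D)) ` \<D>"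
  define D1 where "D1 = {e \<in> E. \<exists>u w. e = {u, w} \<and> c u = 1 \<and> 3 \<le> c w}"
  have finD1: "finite D1" using fin by (simp add: D1_def)
  have D1F: "D1 \<inter> F = {}" by (auto simp: D1_def F_def)
  have "\<exists>r\<in>R. (v, r) \<in> (adj_in F)\<^sup>*" if "v \<in> \<Union>F" for v
  proof -
    have D: "cl v \<in> \<D>" using that by (auto simp: \<D>_def)
    have "rt v \<in> cl (rt v)" by (simp add: cl_def)
    then have "rt v \<in> cl v" using g(1)[OF D] by (simp add: rt_def)
    then have "(v, rt v) \<in> (adj_in F)\<^sup>*" by (simp add: cl_def)
    moreover have "rt v \<in> R" using D by (auto simp: R_def rt_def)
    ultimately show ?thesis by blast
  qed
  \<comment> \<open>The total degree is to be odd exactly at the vertices coloured like the root.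
    The target for \<open>J\<close> therefore discounts the parity already contributed by
    \<open>D1\<close>.\<close>
  from parity_subset[OF finF cardF finUF this, of "\<lambda>w. (c w = c (rt w)) \<noteq> odd (deg D1 w)"]
  obtain J where J: "J \<subseteq> F"
    "\<And>w. w \<in> \<Union>F - R \<Longrightarrow> odd (deg J w) \<longleftrightarrow> (c w = c (rt w)) \<noteq> odd (deg D1 w)" by blast
  have finJ: "finite J" using J(1) finF finite_subset by blast
  \<comment> \<open>The withdrawn edges: the selected edge goes only where the total at the root
    came out even.\<close>
  define Rd where "Rd = (\<lambda>D. {fst (g D), snd (g D)}) ` {D \<in> \<D>. even (deg D1 (fst (g D)) + deg J (fst (g D)))}"
  define A where "A = (D1 - Rd) \<union> J"
  have finA: "finite A" using finD1 finJ by (simp add: A_def)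
  have D1I: "{w, x} \<in> D1" if "P w x" for w x
    using that by (auto simp: D1_def P_def insert_commute)
  have degA: "deg A w = deg (D1 - Rd) w + deg J w" for w
    unfolding A_def using finD1 finJ J(1) D1F by (intro deg_Un) auto
  \<comment> \<open>The second end of a withdrawn edge has colour 1, so its end in \<open>W\<close>
    is the root for which it was selected.\<close>
  have at_top: "\<exists>D\<in>\<D>. even (deg D1 w + deg J w) \<and> fst (g D) = w \<and> e = {w, snd (g D)}"
    if "e \<in> Rd" "w \<in> e" "3 \<le> c w" for e w
  proof -
    from that obtain D where D: "D \<in> \<D>" "even (deg D1 (fst (g D)) + deg J (fst (g D)))"
      "e = {fst (g D), snd (g D)}" by (auto simp: Rd_def)
    have "c (snd (g D)) = 1" using g(2)[OF D(1)] by (simp add: P_def)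
    then have "w = fst (g D)" using that D(3) by auto
    then show ?thesis using D by auto
  qed
  have parity: "odd (deg A w) \<longleftrightarrow> c w = c (rt w)" if w: "w \<in> \<Union>F" for w
  proof (cases "w \<in> R")
    case False
    have w3: "3 \<le> c w" using w by (auto simp: F_def)
    have "e \<notin> Rd" if "w \<in> e" for e
    proof
      assume "e \<in> Rd"
      from at_top[OF this that w3] have "w \<in> R" by (auto simp: R_def)
      with False show False ..
    qed
    then have "deg (D1 - Rd) w = deg D1 w" by (intro deg_cong) auto
    then show ?thesis using J(2)[of w] w False by (auto simp: degA)
  next
    case True
    then obtain D where D: "D \<in> \<D>" "w = fst (g D)" by (auto simp: R_def)
    have cw: "cl w = D" using g(1) D by simp
    then have rw: "rt w = w" using D by (simp add: rt_def)
    have P: "P w (snd (g D))" using g(2) D by simp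
    then have w3: "3 \<le> c w" by (simp add: P_def)
    have same: "e = {w, snd (g D)} \<and> even (deg D1 w + deg J w)" if "e \<in> Rd" "w \<in> e" for e
      using at_top[OF that w3] g(1) cw by auto
    have "odd (deg (D1 - Rd) w + deg J w)"
    proof (cases "even (deg D1 w + deg J w)")
      case True
      have "{w, snd (g D)} \<in> Rd" unfolding Rd_def using D True by blast
      then have "deg (D1 - Rd) w = deg (D1 - {{w, snd (g D)}}) w"
        using same by (intro deg_cong) blast
      moreover have "deg D1 w = Suc (deg (D1 - {{w, snd (g D)}}) w)"
        using finD1 D1I[OF P] by (intro deg_remove) auto
      ultimately show ?thesis using True by simp
    next
      case False
      then have "deg (D1 - Rd) w = deg D1 w" using same by (intro deg_cong) blast
      then show ?thesis using False by simp
    qed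
    then show ?thesis using rw by (simp add: degA)
  qed
  show thesis
  proof (rule that[of A])
    show "A \<subseteq> {e \<in> E. \<exists>u w. e = {u, w} \<and> 3 \<le> c w \<and> (c u = 1 \<or> 3 \<le> c u)}"
    proof
      fix e assume "e \<in> A"
      then consider "e \<in> D1" | "e \<in> F" using J(1) by (auto simp: A_def)
      then show "e \<in> {e \<in> E. \<exists>u w. e = {u, w} \<and> 3 \<le> c w \<and> (c u = 1 \<or> 3 \<le> c u)}"
      proof cases
        case 1 then show ?thesis by (auto simp: D1_def)
      next
        case 2
        then obtain u w where "e = {u, w}" using cardF[OF 2] by (auto simp: card_2_iff)
        then show ?thesis using 2 by (auto simp: F_def)
      qed
    qed
  next
    fix w assume w: "w \<in> \<Union>E" "3 \<le> c w"
    show "deg A w > 0"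
    proof (cases "w \<in> R")
      case True
      then obtain D where D: "D \<in> \<D>" "w = fst (g D)" by (auto simp: R_def)
      then have "cl w = D" using g(1) by simp
      then have rw: "rt w = w" using D by (simp add: rt_def)
      from D(1) obtain w0 where w0: "w0 \<in> \<Union>F" "cl w0 = D" by (auto simp: \<D>_def)
      have "w \<in> cl w" by (simp add: cl_def)
      then have "w \<in> cl w0" using \<open>cl w = D\<close> w0(2) by simp
      then have "(w0, w) \<in> (adj_in F)\<^sup>*" by (simp add: cl_def)
      then have "w \<in> \<Union>F" using w0(1) by (cases rule: rtranclE) auto
      \<comment> \<open>A root ends with odd, hence positive, degree even if it lost an edge; the
        other vertices of \<open>W\<close> lose none.\<close>
      then show ?thesis using parity rw by (metis even_zero gr0I)
    next
      case False
      obtain x where x: "{w, x} \<in> E" "c x = 1" using down[OF w, of 1] by auto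
      have P: "P w x" using x w by (simp add: P_def)
      have "{w, x} \<notin> Rd"
      proof
        assume "{w, x} \<in> Rd"
        from at_top[OF this _ w(2)] have "w \<in> R" by (auto simp: R_def)
        with False show False ..
      qed
      then have "{w, x} \<in> A" using D1I[OF P] by (simp add: A_def)
      then show ?thesis using finA by (intro deg_pos) auto
    qed
  next
    fix w w' assume e: "{w, w'} \<in> E" "3 \<le> c w" "3 \<le> c w'"
    then have eF: "{w, w'} \<in> F" by (auto simp: F_def)
    then have r: "rt w' = rt w" using cl_adj by (simp add: rt_def)
    have "cl w \<in> \<D>" using eF by (auto simp: \<D>_def)
    from g(2)[OF this] have P: "P (rt w) (snd (g (cl w)))" by (simp add: rt_def)
    then have "rt w \<in> \<Union>E" "3 \<le> c (rt w)" by (auto simp: P_def)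
    then have "c w = c (rt w) \<longleftrightarrow> c w' \<noteq> c (rt w)"
      using colours[of w] colours[of w'] colours[of "rt w"] e proper[OF e(1)] edge_ends[OF e(1)] by auto
    then have "odd (deg A w) \<noteq> odd (deg A w')" using parity[of w] parity[of w'] eF r by auto
    then show "deg A w \<noteq> deg A w'" by auto
  next
    fix u w assume u: "{u, w} \<in> E" "c u = 1" "3 \<le> c w"
    have Pw: "P w u" using u by (simp add: P_def insert_commute)
    \<comment> \<open>If \<open>u\<close> is the end of a selected edge, \<open>spare_choice\<close>
      supplies an unselected edge at \<open>u\<close>; otherwise \<open>{w, u}\<close> itself is
      unselected.\<close>
    have "\<exists>v. P v u \<and> (v, u) \<notin> g ` \<D>"
    proof (cases "\<exists>D\<in>\<D>. snd (g D) = u")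
      case True then show ?thesis using g(3) by blast
    next
      case False then show ?thesis using Pw by (metis imageE snd_conv)
    qed
    then obtain v where v: "P v u" "(v, u) \<notin> g ` \<D>" by blast
    have "{v, u} \<notin> Rd"
    proof
      assume "{v, u} \<in> Rd"
      moreover have "3 \<le> c v" using v by (simp add: P_def)
      ultimately obtain D where D: "D \<in> \<D>" "fst (g D) = v" "{v, u} = {v, snd (g D)}"
        using at_top[of "{v, u}" v] by blast
      then have "u = snd (g D)" using \<open>3 \<le> c v\<close> u(2) by (auto simp: doubleton_eq_iff)
      then have "g D = (v, u)" using D by (metis prod.collapse)
      then show False using v(2) D(1) by (metis imageI)
    qed
    then have "{v, u} \<in> A" using D1I[OF v(1)] by (simp add: A_def)
    then show "deg A u > 0" using finA by (intro deg_pos) auto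
  qed
qed

section \<open>Vertices without neighbour in colours 3 and 4\<close>

text \<open>By \<open>reach\<close> every component meets \<open>W\<close>, so a walk from any
  vertex of \<open>L\<close> can leave \<open>L\<close>; the exits serve as roots for the parity
  argument.\<close>

lemma distinguishing_exists:
  assumes reach: "\<And>v. v \<in> \<Union>E \<Longrightarrow> \<exists>w. 3 \<le> c w \<and> (v, w) \<in> (adj_in E)\<^sup>*"
  shows "\<exists>A B. distinguishing E A B"
proof -
  obtain A0 where A0: "A0 \<subseteq> {e \<in> E. \<exists>u w. e = {u, w} \<and> 3 \<le> c w \<and> (c u = 1 \<or> 3 \<le> c u)}"
    and A0_top: "\<And>w. w \<in> \<Union>E \<Longrightarrow> 3 \<le> c w \<Longrightarrow> deg A0 w > 0"
    and A0_neq: "\<And>w w'. {w, w'} \<in> E \<Longrightarrow> 3 \<le> c w \<Longrightarrow> 3 \<le> c w' \<Longrightarrow> deg A0 w \<noteq> deg A0 w'"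
    and A0_bot: "\<And>u w. {u, w} \<in> E \<Longrightarrow> c u = 1 \<Longrightarrow> 3 \<le> c w \<Longrightarrow> deg A0 u > 0"
    by (rule upper_edges) blast
  have sym: "{u, v} \<in> E \<Longrightarrow> {v, u} \<in> E" for u v by (simp add: insert_commute)
  \<comment> \<open>\<open>L\<close>: vertices without neighbour in \<open>W\<close>. \<open>T\<close>: its components containing some \<open>x\<close> of colour 1 with a
    neighbour of colour 2 outside \<open>L\<close> (roots \<open>R1\<close>); they receive the 2-edges \<open>J1\<close>. The other components
    contain some \<open>v\<close> of colour 2 with a neighbour of colour 1 outside \<open>L\<close> (roots \<open>R2\<close>) and receive
    the 3-edges \<open>J2\<close>. The edges of \<open>J1\<close> may leave \<open>L\<close>, those of \<open>J2\<close> may not.\<close>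
  define L where "L = {v \<in> \<Union>E. c v \<le> 2 \<and> (\<forall>w. {v, w} \<in> E \<longrightarrow> c w \<le> 2)}"
  define EL where "EL = {e \<in> E. e \<subseteq> L}"
  define R1 where "R1 = {x \<in> L. c x = 1 \<and> (\<exists>y. {x, y} \<in> E \<and> c y = 2 \<and> y \<notin> L)}"
  define R2 where "R2 = {v \<in> L. c v = 2 \<and> (\<exists>u. {v, u} \<in> E \<and> c u = 1 \<and> u \<notin> L)}"
  define T where "T = {z \<in> L. \<exists>x\<in>R1. (z, x) \<in> (adj_in EL)\<^sup>*}"
  define H1 where "H1 = {e \<in> E. \<exists>u v. e = {u, v} \<and> v \<in> T \<and> c v = 2}"
  define H2 where "H2 = {e \<in> E. \<exists>x v. e = {x, v} \<and> x \<in> L - T \<and> c x = 1}"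
  have L_low: "c z \<le> 2" "c z' \<le> 2" if "{z, z'} \<in> E" "z \<in> L" for z z'
    using that by (auto simp: L_def)
  have L_nbr: "c z' = 3 - c z" "c z = 1 \<or> c z = 2" if "{z, z'} \<in> E" "z \<in> L" for z z'
    using L_low[OF that] proper[OF that(1)] colours[of z] colours[of z'] edge_ends[OF that(1)] by auto
  have TL: "T \<subseteq> L" by (auto simp: T_def)
  have R1T: "R1 \<subseteq> T" by (auto simp: T_def R1_def)
  have T_step: "z' \<in> T" if "{z, z'} \<in> E" "z' \<in> L" "z \<in> T" for z z'
  proof -
    have "(z', z) \<in> adj_in EL" using that TL sym by (auto simp: EL_def)
    then show ?thesis using that unfolding T_def by (blast intro: converse_rtrancl_into_rtrancl)
  qed
  \<comment> \<open>A vertex of colour 1 in \<open>L - T\<close> is not in \<open>R1\<close>, so its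
    neighbours, all of colour 2, lie in \<open>L\<close>; they avoid \<open>T\<close> because
    \<open>T\<close> is closed under adjacency within \<open>L\<close>.\<close>
  have H2_ends: "z \<in> L - T" if "e \<in> H2" "z \<in> e" for e z
  proof -
    from that obtain x v where xv: "{x, v} \<in> E" "e = {x, v}" "x \<in> L - T" "c x = 1"
      by (auto simp: H2_def)
    have "c v = 2" using L_nbr[of x v] xv by auto
    then have "v \<in> L" using R1T xv by (auto simp: R1_def)
    moreover have "v \<notin> T" using T_step[of v x] xv sym by blast
    ultimately show ?thesis using that xv by auto
  qed
  have H2_at: "{x, v} \<in> H2" if "{x, v} \<in> E" "x \<in> L - T" "c x = 1" for x v
    using that by (auto simp: H2_def)
  \<comment> \<open>Follow a walk to \<open>W\<close> until it leaves \<open>L\<close>, staying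
    outside \<open>T\<close> up to then. An exit from colour 1 to colour 2 would start in
    \<open>R1\<close>, so the exit goes from colour 2 to colour 1 and starts in
    \<open>R2\<close>.\<close>
  have reach2: "\<exists>r\<in>R2. (z, r) \<in> (adj_in H2)\<^sup>*" if "z \<in> L - T" for z
  proof -
    from that obtain w where w: "3 \<le> c w" "(z, w) \<in> (adj_in E)\<^sup>*" using reach[of z] by (auto simp: L_def)
    have "w \<notin> L" using w by (auto simp: L_def)
    from w(2) that show ?thesis
    proof (induction rule: converse_rtrancl_induct)
      case base
      then show ?case using \<open>w \<notin> L\<close> by blast
    next
      case (step z z')
      have e: "{z, z'} \<in> E" and z: "z \<in> L" "z \<notin> T" using step by auto
      show ?case
      proof (cases "z' \<in> L")
        case True
        then have "z' \<notin> T" using T_step[of z' z] z e sym by blast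
        then obtain r where r: "r \<in> R2" "(z', r) \<in> (adj_in H2)\<^sup>*" using step.IH True by blast
        have "{z, z'} \<in> H2"
        proof (cases "c z = 1")
          case True then show ?thesis using H2_at e z by blast
        next
          case False
          then have "c z' = 1" using L_nbr[OF e z(1)] by auto
          then show ?thesis using H2_at[of z' z] sym[OF e] \<open>z' \<in> L\<close> \<open>z' \<notin> T\<close> by (simp add: insert_commute)
        qed
        then have "(z, r) \<in> (adj_in H2)\<^sup>*" using r(2) by (simp add: converse_rtrancl_into_rtrancl)
        then show ?thesis using r(1) by blast
      next
        case False
        have "\<not> (c z = 1 \<and> c z' = 2)" using e z R1T False unfolding R1_def by blast
        then have "c z = 2 \<and> c z' = 1" using L_nbr[OF e z(1)] by auto
        then have "z \<in> R2" using z e False by (auto simp: R2_def)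
        then show ?thesis by blast
      qed
    qed
  qed
  have T_reach1: "\<exists>r\<in>R1. (z, r) \<in> (adj_in H1)\<^sup>*" if "z \<in> T" for z
  proof -
    from that obtain x where x: "x \<in> R1" "(z, x) \<in> (adj_in EL)\<^sup>*" by (auto simp: T_def)
    have "(z, x) \<in> (adj_in H1)\<^sup>* \<and> z \<in> T"
      using x(2)
    proof (induction rule: converse_rtrancl_induct)
      case base
      then show ?case using x R1T by auto
    next
      case (step z z')
      have e: "{z, z'} \<in> E" and L: "z \<in> L" "z' \<in> L" using step.hyps by (auto simp: EL_def)
      have "z' \<in> T" using step.IH by blast
      then have "z \<in> T" using T_step[of z' z] sym e L by blast
      have "{z, z'} \<in> H1"
      proof (cases "c z = 2")
        case True
        then show ?thesis using e \<open>z \<in> T\<close> by (auto simp: H1_def insert_commute)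
      next
        case False
        then have "c z' = 2" using L_nbr[OF e L(1)] by auto
        then show ?thesis using e \<open>z' \<in> T\<close> by (auto simp: H1_def)
      qed
      then show ?case using step.IH \<open>z \<in> T\<close> by (simp add: converse_rtrancl_into_rtrancl)
    qed
    then show ?thesis using x by blast
  qed
  have reach1: "\<exists>r\<in>R1. (z, r) \<in> (adj_in H1)\<^sup>*" if "z \<in> \<Union>H1" for z
  proof -
    from that obtain u v where uv: "{u, v} \<in> E" "v \<in> T" "c v = 2" "z \<in> {u, v}" by (auto simp: H1_def)
    obtain r where r: "r \<in> R1" "(v, r) \<in> (adj_in H1)\<^sup>*" using T_reach1 uv by blast
    have "{u, v} \<in> H1" using uv by (auto simp: H1_def)
    then have "(u, r) \<in> (adj_in H1)\<^sup>*" using r(2) by (simp add: converse_rtrancl_into_rtrancl)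
    then show ?thesis using r uv by auto
  qed
  have H1_ends: "(z \<in> T \<and> c z = 2) \<or> (c z = 1 \<and> (z \<in> L \<longrightarrow> z \<in> T))" if "e \<in> H1" "z \<in> e" for e z
  proof -
    from that obtain u v where uv: "{u, v} \<in> E" "e = {u, v}" "v \<in> T" "c v = 2" by (auto simp: H1_def)
    have "c u = 1" using L_nbr[of v u] uv TL sym by auto
    moreover have "u \<in> L \<longrightarrow> u \<in> T" using T_step[of v u] uv sym by blast
    ultimately show ?thesis using that uv by auto
  qed
  have finH: "finite H1" "finite H2" using fin by (auto simp: H1_def H2_def)
  have cardH: "\<And>e. e \<in> H1 \<Longrightarrow> card e = 2" "\<And>e. e \<in> H2 \<Longrightarrow> card e = 2"
    using card2 by (auto simp: H1_def H2_def)
  have finUH: "finite (\<Union>H1)" "finite (\<Union>H2)"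
    using fin_verts by (rule rev_finite_subset, auto simp: H1_def H2_def)+
  have "\<exists>r\<in>R2. (z, r) \<in> (adj_in H2)\<^sup>*" if "z \<in> \<Union>H2" for z
    using that reach2 H2_ends by blast
  from parity_subset[OF finH(2) cardH(2) finUH(2) this, of "\<lambda>v. c v = 1"]
  obtain J2 where J2: "J2 \<subseteq> H2" "\<And>v. v \<in> \<Union>H2 \<Longrightarrow> v \<notin> R2 \<Longrightarrow> odd (deg J2 v) \<longleftrightarrow> c v = 1" by blast
  \<comment> \<open>Roots of colour 2 with the wrong, odd, 3-degree. One added 2-edge turns the pair
    into (1, odd), unlike (0, odd) at colour 1 in \<open>L - T\<close> and (positive, 0) at colour 1
    outside \<open>L\<close>.\<close>
  define bad2 where "bad2 = {v \<in> R2. odd (deg J2 v)}"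
  define f where "f v = (SOME u. {v, u} \<in> E \<and> c u = 1 \<and> u \<notin> L)" for v
  have f: "{v, f v} \<in> E" "c (f v) = 1" "f v \<notin> L" if "v \<in> bad2" for v
  proof -
    have "\<exists>u. {v, u} \<in> E \<and> c u = 1 \<and> u \<notin> L" using that by (auto simp: bad2_def R2_def)
    from someI_ex[OF this] show "{v, f v} \<in> E" "c (f v) = 1" "f v \<notin> L" by (auto simp: f_def)
  qed
  have bad2: "v \<in> L - T" "c v = 2" if "v \<in> bad2" for v
  proof -
    have "deg J2 v \<noteq> 0" using that by (auto simp: bad2_def elim: oddE)
    then obtain e where "e \<in> J2" "v \<in> e" by (metis deg_eq_0)
    then show "v \<in> L - T" using H2_ends J2(1) by blast
    show "c v = 2" using that by (auto simp: bad2_def R2_def)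
  qed
  define M where "M = (\<lambda>v. {v, f v}) ` bad2"
  have M_E: "M \<subseteq> E" using f by (auto simp: M_def)
  have A0_E: "A0 \<subseteq> E" using A0 by auto
  have A0_ends: "c z = 1 \<or> 3 \<le> c z" "z \<notin> L" if "e \<in> A0" "z \<in> e" for e z
  proof -
    from that A0 obtain u w where uw: "{u, w} \<in> E" "e = {u, w}" "3 \<le> c w" "c u = 1 \<or> 3 \<le> c u" by blast
    then show "c z = 1 \<or> 3 \<le> c z" using that by auto
    show "z \<notin> L" using that uw L_low[of u w] L_low[of w u] sym[of u w] by force
  qed
  have M_ends: "(z \<in> bad2 \<and> e = {z, f z}) \<or> (c z = 1 \<and> z \<notin> L)" if "e \<in> M" "z \<in> e" for e z
    using that f by (auto simp: M_def)
  have "finite A0" "finite M" using A0_E M_E fin finite_subset by blast+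
  define A1 where "A1 = A0 \<union> M"
  have finA1: "finite A1" using \<open>finite A0\<close> \<open>finite M\<close> by (simp add: A1_def)
  \<comment> \<open>\<open>J1\<close> is chosen after \<open>A0\<close> and \<open>M\<close> and
    compensates their parities, because \<open>H1\<close> may contain vertices of colour 1 outside
    \<open>L\<close> that already carry 2-edges. These must become even, as colour 2 in
    \<open>T\<close> is odd.\<close>
  from parity_subset[OF finH(1) cardH(1) finUH(1) reach1, of "\<lambda>u. (c u = 2) \<noteq> odd (deg A1 u)"]
  obtain J1 where J1: "J1 \<subseteq> H1"
    "\<And>u. u \<in> \<Union>H1 \<Longrightarrow> u \<notin> R1 \<Longrightarrow> odd (deg J1 u) \<longleftrightarrow> (c u = 2) \<noteq> odd (deg A1 u)" by blast
  have finJ: "finite J1" "finite J2" using J1(1) J2(1) finH finite_subset by blast+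
  define A where "A = A1 \<union> J1"
  have finA: "finite A" using finA1 finJ by (simp add: A_def)
  \<comment> \<open>The mirror image of \<open>bad2\<close>: a root of colour 1 with odd 2-degree
    receives one 3-edge, to colour 2 outside \<open>L\<close>.\<close>
  define bad1 where "bad1 = {x \<in> R1. odd (deg A x)}"
  define h where "h x = (SOME y. {x, y} \<in> E \<and> c y = 2 \<and> y \<notin> L)" for x
  have h: "{x, h x} \<in> E" "c (h x) = 2" "h x \<notin> L" if "x \<in> bad1" for x
  proof -
    have "\<exists>y. {x, y} \<in> E \<and> c y = 2 \<and> y \<notin> L" using that by (auto simp: bad1_def R1_def)
    from someI_ex[OF this] show "{x, h x} \<in> E" "c (h x) = 2" "h x \<notin> L" by (auto simp: h_def)
  qed
  define N where "N = (\<lambda>x. {x, h x}) ` bad1"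
  define B0 where "B0 = {e \<in> E. \<exists>v w. e = {v, w} \<and> c v = 2 \<and> 3 \<le> c w}"
  define B where "B = B0 \<union> J2 \<union> N"
  have bad1: "x \<in> T" "c x = 1" if "x \<in> bad1" for x
    using that R1T by (auto simp: bad1_def R1_def)
  have N_E: "N \<subseteq> E" using h by (auto simp: N_def)
  have N_ends: "(z \<in> bad1 \<and> e = {z, h z}) \<or> (c z = 2 \<and> z \<notin> L)" if "e \<in> N" "z \<in> e" for e z
    using that h by (auto simp: N_def)
  have B0_ends: "c z = 2 \<or> 3 \<le> c z" "z \<notin> L" if "e \<in> B0" "z \<in> e" for e z
  proof -
    from that obtain u w where uw: "{u, w} \<in> E" "e = {u, w}" "3 \<le> c w" "c u = 2" by (auto simp: B0_def)
    then show "c z = 2 \<or> 3 \<le> c z" using that by auto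
    show "z \<notin> L" using that uw L_low[of u w] L_low[of w u] sym[of u w] by force
  qed
  have AE: "A \<subseteq> E" using A0_E M_E J1(1) by (auto simp: A_def A1_def H1_def)
  have BE: "B \<subseteq> E" using N_E J2(1) by (auto simp: B_def B0_def H2_def)
  have finB: "finite B" using BE fin finite_subset by blast
  have disj1: "A1 \<inter> J1 = {}"
  proof -
    have False if e: "e \<in> A1" "e \<in> J1" for e
    proof -
      from e(2) J1(1) obtain u v where uv: "e = {u, v}" "v \<in> T" "c v = 2" by (auto simp: H1_def)
      have "e \<in> A0 \<or> e \<in> M" using e(1) by (auto simp: A1_def)
      then show False
      proof
        assume "e \<in> A0" then show False using A0_ends(2)[of e v] uv TL by auto
      next
        assume "e \<in> M" then show False using M_ends[of e v] bad2[of v] uv by auto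
      qed
    qed
    then show ?thesis by blast
  qed
  have degA: "deg A z = deg A1 z + deg J1 z" for z
    unfolding A_def using finA1 finJ(1) disj1 by (rule deg_Un)
  have H1_parity: "odd (deg A z) \<longleftrightarrow> c z = 2" if "z \<in> \<Union>H1" "z \<notin> R1" for z
    using J1(2)[OF that] by (auto simp: degA)
  \<comment> \<open>Next the pairs \<open>(deg A z, deg B z)\<close> are determined. On
    \<open>W\<close>: both positive. Outside \<open>L\<close>: (positive, 0) at colour 1, (0,
    positive) at colour 2. On \<open>L - T\<close>: (0, odd) at colour 1, (0, even) or (1, odd) at
    colour 2. On \<open>T\<close>: (even, 0) or (odd, 1) at colour 1, (odd, 0) at colour 2.\<close>
  have top_A: "deg A w = deg A0 w" if "3 \<le> c w" for w
  proof (rule deg_cong)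
    fix e assume w: "w \<in> e"
    have "e \<notin> M" using M_ends[of e w] w that bad2[of w] by auto
    moreover have "e \<notin> J1" using H1_ends[of e w] J1(1) w that by auto
    ultimately show "e \<in> A \<longleftrightarrow> e \<in> A0" by (auto simp: A_def A1_def)
  qed
  have top: "deg A w > 0 \<and> deg B w > 0" if w: "w \<in> \<Union>E" "3 \<le> c w" for w
  proof
    show "deg A w > 0" using top_A A0_top w by simp
    obtain x where "{w, x} \<in> E" "c x = 2" using down[OF w, of 2] by auto
    then have "{w, x} \<in> B" using w by (auto simp: B_def B0_def insert_commute)
    then show "deg B w > 0" using finB by (intro deg_pos) auto
  qed
  have high: "\<exists>w. {z, w} \<in> E \<and> 3 \<le> c w" if "z \<in> \<Union>E" "z \<notin> L" "c z \<le> 2" for z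
    using that by (auto simp: L_def not_le numeral_eq_Suc less_Suc_eq_le Suc_le_eq)
  have high1: "deg A u > 0 \<and> deg B u = 0" if u: "u \<in> \<Union>E" "u \<notin> L" "c u = 1" for u
  proof
    obtain w where "{u, w} \<in> E" "3 \<le> c w" using high[OF u(1,2)] u(3) by auto
    then have "deg A0 u > 0" using A0_bot u by blast
    then obtain e where "e \<in> A0" "u \<in> e" by (metis deg_eq_0 less_irrefl)
    then show "deg A u > 0" using finA by (intro deg_pos) (auto simp: A_def A1_def)
    show "deg B u = 0"
    proof (rule deg_eq_0)
      fix e assume "e \<in> B"
      then show "u \<notin> e" using u B0_ends(1)[of e u] H2_ends[of e u] J2(1) N_ends[of e u] bad1[of u] TL
        by (auto simp: B_def)
    qed
  qed
  have high2: "deg A y = 0 \<and> deg B y > 0" if y: "y \<in> \<Union>E" "y \<notin> L" "c y = 2" for y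
  proof
    obtain w where "{y, w} \<in> E" "3 \<le> c w" using high[OF y(1,2)] y(3) by auto
    then have "{y, w} \<in> B" using y by (auto simp: B_def B0_def)
    then show "deg B y > 0" using finB by (intro deg_pos) auto
    show "deg A y = 0"
    proof (rule deg_eq_0)
      fix e assume "e \<in> A"
      then show "y \<notin> e" using y A0_ends(1)[of e y] H1_ends[of e y] J1(1) M_ends[of e y] bad2[of y] TL
        by (auto simp: A_def A1_def)
    qed
  qed
  have low1: "deg A x = 0 \<and> odd (deg B x)" if x: "x \<in> L - T" "c x = 1" for x
  proof
    show "deg A x = 0"
    proof (rule deg_eq_0)
      fix e assume "e \<in> A"
      then show "x \<notin> e" using x A0_ends(2)[of e x] H1_ends[of e x] J1(1) M_ends[of e x] bad2[of x]
        by (auto simp: A_def A1_def)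
    qed
    have "deg B x = deg J2 x"
    proof (rule deg_cong)
      fix e assume e: "x \<in> e"
      then show "e \<in> B \<longleftrightarrow> e \<in> J2" using x B0_ends(2)[of e x] N_ends[of e x] bad1[of x]
        by (auto simp: B_def)
    qed
    moreover have "x \<in> \<Union>H2"
    proof -
      from x obtain e where e: "e \<in> E" "x \<in> e" by (auto simp: L_def)
      obtain v where "e = {x, v}" using card2_obtain[OF card2[OF e(1)] e(2)] by blast
      then show ?thesis using H2_at[of x v] e x by blast
    qed
    moreover have "x \<notin> R2" using x by (auto simp: R2_def)
    ultimately show "odd (deg B x)" using J2(2) x by simp
  qed
  have low2: "deg A v = (if odd (deg B v) then 1 else 0)" if v: "v \<in> L - T" "c v = 2" for v
  proof -
    have B: "deg B v = deg J2 v"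
    proof (rule deg_cong)
      fix e assume e: "v \<in> e"
      then show "e \<in> B \<longleftrightarrow> e \<in> J2" using v B0_ends(2)[of e v] N_ends[of e v] bad1[of v]
        by (auto simp: B_def)
    qed
    have only: "v \<in> bad2 \<and> e = {v, f v}" if "e \<in> A" "v \<in> e" for e
      using that v A0_ends(2)[of e v] H1_ends[of e v] J1(1) M_ends[of e v] by (auto simp: A_def A1_def)
    show ?thesis
    proof (cases "v \<in> bad2")
      case True
      then have "{v, f v} \<in> A" by (auto simp: A_def A1_def M_def)
      then have "deg A v = 1" using only by (intro deg_eq_1) auto
      then show ?thesis using True B by (auto simp: bad2_def)
    next
      case False
      then have "deg A v = 0" using only by (intro deg_eq_0) blast
      moreover have "even (deg J2 v)"
      proof (cases "v \<in> \<Union>H2")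
        case True then show ?thesis using J2(2)[of v] v False by (auto simp: bad2_def)
      next
        case False
        then have "deg J2 v = 0" using J2(1) by (intro deg_eq_0) blast
        then show ?thesis by simp
      qed
      ultimately show ?thesis using B by simp
    qed
  qed
  have lowT1: "deg B x = (if odd (deg A x) then 1 else 0)" if x: "x \<in> T" "c x = 1" for x
  proof -
    have only: "x \<in> bad1 \<and> e = {x, h x}" if "e \<in> B" "x \<in> e" for e
      using that x TL B0_ends(2)[of e x] H2_ends[of e x] J2(1) N_ends[of e x] by (auto simp: B_def)
    show ?thesis
    proof (cases "x \<in> bad1")
      case True
      then have "{x, h x} \<in> B" by (auto simp: B_def N_def)
      then have "deg B x = 1" using only by (intro deg_eq_1) auto
      then show ?thesis using True by (auto simp: bad1_def)
    next
      case False
      then have "deg B x = 0" using only by (intro deg_eq_0) blast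
      moreover have "even (deg A x)"
      proof (cases "x \<in> R1")
        case True then show ?thesis using False by (auto simp: bad1_def)
      next
        case R: False
        show ?thesis
        proof (cases "x \<in> \<Union>H1")
          case True then show ?thesis using H1_parity[of x] R x by simp
        next
          case False
          have "deg A x = 0"
          proof (rule deg_eq_0)
            fix e assume "e \<in> A"
            then show "x \<notin> e" using x TL False J1(1) A0_ends(2)[of e x] M_ends[of e x] bad2[of x]
              by (auto simp: A_def A1_def)
          qed
          then show ?thesis by simp
        qed
      qed
      ultimately show ?thesis by simp
    qed
  qed
  have lowT2: "odd (deg A v) \<and> deg B v = 0" if v: "v \<in> T" "c v = 2" for v
  proof
    from v TL obtain e where e: "e \<in> E" "v \<in> e" by (auto simp: L_def)
    obtain u where "e = {v, u}" using card2_obtain[OF card2[OF e(1)] e(2)] by blast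
    then have "v \<in> \<Union>H1" using e v by (auto simp: H1_def insert_commute)
    moreover have "v \<notin> R1" using v by (auto simp: R1_def)
    ultimately show "odd (deg A v)" using H1_parity v by simp
    show "deg B v = 0"
    proof (rule deg_eq_0)
      fix e assume "e \<in> B"
      then show "v \<notin> e" using v TL B0_ends(2)[of e v] H2_ends[of e v] J2(1) N_ends[of e v] bad1[of v]
        by (auto simp: B_def)
    qed
  qed
  \<comment> \<open>No edge joins \<open>T\<close> to \<open>L - T\<close>, and the colour 1
    neighbours in \<open>L\<close> of a colour 2 vertex outside \<open>L\<close> lie in
    \<open>R1\<close>, hence in \<open>T\<close>. The remaining combinations of pairs all
    differ.\<close>
  have ordered: "deg A u \<noteq> deg A v \<or> deg B u \<noteq> deg B v" if e: "{u, v} \<in> E" and lt: "c u < c v" for u v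
  proof -
    have uv: "u \<in> \<Union>E" "v \<in> \<Union>E" using edge_ends[OF e] .
    show ?thesis
    proof (cases "3 \<le> c v")
      case v3: True
      show ?thesis
      proof (cases "3 \<le> c u")
        case True
        then show ?thesis using A0_neq[OF e True v3] top_A v3 by simp
      next
        case False
        then have "u \<notin> L" using L_low[OF e] v3 by auto
        moreover have "c u = 1 \<or> c u = 2" using False colours[OF uv(1)] by auto
        ultimately show ?thesis using top[OF uv(2) v3] high1[OF uv(1)] high2[OF uv(1)] by auto
      qed
    next
      case False
      then have c: "c u = 1" "c v = 2" using lt colours[OF uv(1)] by auto
      show ?thesis
      proof (cases "v \<in> L")
        case vL: True
        show ?thesis
        proof (cases "v \<in> T")
          case vT: True
          have "even (deg A u) \<or> deg B u \<noteq> 0"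
          proof (cases "u \<in> L")
            case True
            then have "u \<in> T" using T_step[of v u] sym e vT by blast
            then show ?thesis using lowT1 c by simp
          next
            case False
            have "u \<in> \<Union>H1" using e vT c by (auto simp: H1_def)
            moreover have "u \<notin> R1" using False by (auto simp: R1_def)
            ultimately show ?thesis using H1_parity[of u] c by simp
          qed
          then show ?thesis using lowT2[OF vT c(2)] by auto
        next
          case vT: False
          then have v: "deg A v = (if odd (deg B v) then 1 else 0)" using low2 vL c by blast
          show ?thesis
          proof (cases "u \<in> L")
            case True
            then have "u \<in> L - T" using T_step[of u v] e vT vL by blast
            then show ?thesis using low1 c v by fastforce
          next
            case False
            then show ?thesis using high1[OF uv(1) False c(1)] v by (cases "odd (deg B v)") (auto dest: odd_pos)
          qed
        qed
      next
        case vL: False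
        have v: "deg A v = 0" "deg B v > 0" using high2[OF uv(2) vL c(2)] by auto
        show ?thesis
        proof (cases "u \<in> L")
          case True
          then have "u \<in> T" using R1T e c vL by (auto simp: R1_def)
          from lowT1[OF this c(1)] v show ?thesis by (cases "odd (deg A u)") auto
        next
          case False
          then show ?thesis using high1[OF uv(1) False c(1)] v by auto
        qed
      qed
    qed
  qed
  \<comment> \<open>A common edge makes all four degrees at its ends positive. The pairs found above
    allow this only inside \<open>W\<close>, where \<open>B\<close> has no edge.\<close>
  have "A \<inter> B = {}"
  proof -
    have False if "e \<in> A" "e \<in> B" for e
    proof -
      have "e \<in> E" using that AE by blast
      then obtain u v where uv: "e = {u, v}" "c u < c v" "{u, v} \<in> E"
        using card2[of e] proper by (metis card_2_iff insert_commute linorder_neqE_nat)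
      then have uv': "u \<in> \<Union>E" "v \<in> \<Union>E" by auto
      have pos: "deg A u > 0" "deg A v > 0" "deg B u > 0" "deg B v > 0"
        using that uv(1) finA finB by (auto intro: deg_pos)
      show False
      proof (cases "3 \<le> c v")
        case v3: True
        show False
        proof (cases "3 \<le> c u")
          case True
          have "v \<notin> L" using v3 by (auto simp: L_def)
          then have "e \<in> B0"
            using that(2) uv(1) v3 H2_ends[of e v] J2(1) N_ends[of e v] bad1[of v] by (auto simp: B_def)
          then show False using True v3 uv(1) by (auto simp: B0_def doubleton_eq_iff)
        next
          case False
          then have "u \<notin> L" using L_low[OF uv(3)] v3 by auto
          moreover have "c u = 1 \<or> c u = 2" using False colours[OF uv'(1)] by auto
          ultimately show False using pos high1[OF uv'(1)] high2[OF uv'(1)] by auto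
        qed
      next
        case False
        then have c: "c u = 1" "c v = 2" using uv(2) colours[OF uv'(1)] by auto
        then have v: "v \<in> L - T" using high2[OF uv'(2)] lowT2[of v] pos by auto
        then have "u \<notin> T" using T_step[of u v] uv(3) by blast
        then show False using high1[OF uv'(1)] low1[of u] c pos by auto
      qed
    qed
    then show ?thesis by blast
  qed
  moreover have "deg A u \<noteq> deg A v \<or> deg B u \<noteq> deg B v" if e: "{u, v} \<in> E" for u v
    using ordered[OF e] ordered[OF sym[OF e]] proper[OF e] by (cases "c u < c v") auto
  ultimately have "distinguishing E A B" unfolding distinguishing_def using AE BE by blast
  then show ?thesis by blast
qed

end

section \<open>Existence of a reduced colouring\<close>

text \<open>A colouring minimising \<open>m\<close> is reduced: where \<open>down\<close> fails,
  \<open>w\<close> can take colour \<open>i\<close>, which shrinks \<open>W\<close> without new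
  edges inside; where \<open>spare\<close> fails, a colour exchange at \<open>w\<close> removes an
  edge inside \<open>W\<close>.\<close>

lemma reduced_colouring_exists:
  assumes fin: "finite E" and card2: "\<And>e. e \<in> E \<Longrightarrow> card e = 2"
    and proper0: "\<And>u v. {u, v} \<in> E \<Longrightarrow> c0 u \<noteq> c0 v"
    and colours0: "\<And>v. v \<in> \<Union>E \<Longrightarrow> 1 \<le> c0 v \<and> c0 v \<le> (4::nat)"
  shows "\<exists>c. reduced_colouring E c"
proof -
  define good where "good c \<longleftrightarrow> (\<forall>u v. {u, v} \<in> E \<longrightarrow> c u \<noteq> c v) \<and> (\<forall>v\<in>\<Union>E. 1 \<le> c v \<and> c v \<le> (4::nat))" for c
  define W where "W c = {v \<in> \<Union>E. 3 \<le> c v}" for c :: "'a \<Rightarrow> nat"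
  define F where "F c = {e \<in> E. e \<subseteq> W c}" for c
  \<comment> \<open>Minimising \<open>m\<close> is minimising \<open>(|F|, |W|)\<close> lexicographically.\<close>
  define m where "m c = card (F c) * Suc (card (\<Union>E)) + card (W c)" for c
  have finV: "finite (\<Union>E)" using fin card2 by (metis card.infinite finite_Union zero_neq_numeral)
  have finW: "finite (W c)" for c by (rule finite_subset[OF _ finV]) (auto simp: W_def)
  have finF: "finite (F c)" for c using fin by (simp add: F_def)
  have "good c0" using proper0 colours0 by (simp add: good_def)
  from ex_has_least_nat[of good, OF this, of m] obtain c where
    c: "good c" and min: "\<And>c'. good c' \<Longrightarrow> m c \<le> m c'" by blast
  have proper: "{u, v} \<in> E \<Longrightarrow> c u \<noteq> c v" for u v using c by (simp add: good_def)
  have colours: "v \<in> \<Union>E \<Longrightarrow> 1 \<le> c v \<and> c v \<le> 4" for v using c unfolding good_def by blast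
  have down: "\<exists>x. {w, x} \<in> E \<and> c x = i" if w: "w \<in> \<Union>E" "3 \<le> c w" and i: "i = 1 \<or> i = 2" for w i
  proof (rule ccontr)
    assume no: "\<not> ?thesis"
    define c' where "c' = c(w := i)"
    have "c' u \<noteq> c' v" if e: "{u, v} \<in> E" for u v
    proof -
      have "u \<noteq> v" using proper[OF e] by auto
      moreover have "{v, u} \<in> E" using e by (simp add: insert_commute)
      ultimately show ?thesis using no proper[OF e] e unfolding c'_def by auto
    qed
    then have "good c'" using colours i by (auto simp: good_def c'_def)
    have W: "W c' = W c - {w}" using i w by (auto simp: W_def c'_def)
    then have "F c' \<subseteq> F c" by (auto simp: F_def)
    then have "card (F c') \<le> card (F c)" using finF by (rule card_mono[rotated])
    moreover have "card (W c') < card (W c)" unfolding W using finW w by (intro card_Diff1_less) (auto simp: W_def)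
    ultimately have "m c' < m c" unfolding m_def by (intro add_le_less_mono mult_le_mono1)
    then show False using min[OF \<open>good c'\<close>] by simp
  qed
  have spare: "\<exists>x v. {w, x} \<in> E \<and> c x = 1 \<and> {v, x} \<in> E \<and> 3 \<le> c v \<and> v \<noteq> w"
    if e: "{w, w'} \<in> E" "3 \<le> c w" "3 \<le> c w'" for w w'
  proof (rule ccontr)
    assume no: "\<not> ?thesis"
    \<comment> \<open>Otherwise exchange \<open>w\<close> with its neighbours of colour 1, which removes the edge \<open>ww'\<close> from \<open>W\<close>.\<close>
    define c' where "c' z = (if z = w then 1 else if c z = 1 \<and> {w, z} \<in> E then c w else c z)" for z
    \<comment> \<open>Properness at an edge whose end \<open>v\<close> keeps its colour. In the
      second case \<open>u\<close> receives \<open>c w\<close>, which is at least 3, while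
      \<open>3 \<le> c v\<close> would make \<open>v\<close> the second neighbour excluded by
      \<open>no\<close>.\<close>
    have half: "c' u \<noteq> c' v" if uv: "{u, v} \<in> E" "\<not> (c v = 1 \<and> {w, v} \<in> E)" "v \<noteq> w" for u v
    proof -
      have v: "c' v = c v" using uv(2,3) unfolding c'_def by auto
      consider "u = w" | "u \<noteq> w" "c u = 1 \<and> {w, u} \<in> E" | "u \<noteq> w" "\<not> (c u = 1 \<and> {w, u} \<in> E)" by blast
      then show ?thesis
      proof cases
        case 1
        then show ?thesis using uv v by (simp add: c'_def)
      next
        case 2
        have "{v, u} \<in> E" using uv(1) by (simp add: insert_commute)
        then have "\<not> 3 \<le> c v" using no 2 uv(3) by blast
        then show ?thesis using 2 v e(2) by (auto simp: c'_def)
      next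
        case 3
        then have "c' u = c u" unfolding c'_def by metis
        then show ?thesis using v proper[OF uv(1)] by simp
      qed
    qed
    have "c' u \<noteq> c' v" if uv: "{u, v} \<in> E" for u v
    proof (rule ccontr)
      assume eq: "\<not> c' u \<noteq> c' v"
      have vu: "{v, u} \<in> E" using uv by (simp add: insert_commute)
      have "(c v = 1 \<and> {w, v} \<in> E) \<or> v = w" using half[OF uv] eq by auto
      moreover have "(c u = 1 \<and> {w, u} \<in> E) \<or> u = w" using half[OF vu] eq by auto
      ultimately consider "c u = c v" | "v = w" "u \<noteq> w" "c' u = c w" | "u = w" "v \<noteq> w" "c' v = c w"
        unfolding c'_def by metis
      then show False
        using proper[OF uv] eq e(2) by cases (simp_all add: c'_def)
    qed
    moreover have "1 \<le> c' v \<and> c' v \<le> 4" if "v \<in> \<Union>E" for v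
      using colours[OF that] colours[of w] e(1) by (auto simp: c'_def)
    ultimately have "good c'" by (simp add: good_def)
    \<comment> \<open>Neighbours of \<open>w\<close> that enter \<open>W\<close> bring no edge with
      them: by \<open>no\<close> their only neighbour in the old \<open>W\<close> was
      \<open>w\<close>, which has left.\<close>
    have "f \<in> F c - {{w, w'}}" if f: "f \<in> F c'" for f
    proof -
      have fE: "f \<in> E" using f by (simp add: F_def)
      have "z \<in> W c - {w}" if z: "z \<in> f" for z
      proof -
        obtain y where y: "f = {z, y}" using card2_obtain[OF card2[OF fE] z] by blast
        have W': "z \<in> W c'" "y \<in> W c'" using f y by (auto simp: F_def)
        then have zw: "z \<noteq> w" "y \<noteq> w" by (auto simp: W_def c'_def)
        have "\<not> (c z = 1 \<and> {w, z} \<in> E)"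
        proof
          assume z1: "c z = 1 \<and> {w, z} \<in> E"
          then have "c y \<noteq> 1" using proper fE y by metis
          then have "3 \<le> c y" using W'(2) zw by (simp add: W_def c'_def)
          moreover have "{y, z} \<in> E" using fE y by (simp add: insert_commute)
          ultimately show False using no z1 zw by blast
        qed
        then show ?thesis using W'(1) zw by (auto simp: W_def c'_def)
      qed
      then show ?thesis using fE by (auto simp: F_def)
    qed
    then have "F c' \<subseteq> F c - {{w, w'}}" by blast
    then have "card (F c') \<le> card (F c - {{w, w'}})" using finF by (intro card_mono) auto
    moreover have "{w, w'} \<in> F c" using e by (auto simp: F_def W_def)
    ultimately have "Suc (card (F c')) \<le> card (F c)"
      using finF by (metis card_Diff1_less less_eq_Suc_le order_le_less_trans)
    \<comment> \<open>\<open>W\<close> may grow in the exchange, but its size never exceeds the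
      number of vertices, so one edge fewer outweighs it in \<open>m\<close>.\<close>
    then have "Suc (card (F c')) * Suc (card (\<Union>E)) \<le> card (F c) * Suc (card (\<Union>E))"
      by (rule mult_le_mono1)
    moreover have "card (W c') \<le> card (\<Union>E)" using finV by (intro card_mono) (auto simp: W_def)
    ultimately have "m c' < m c" unfolding m_def by simp
    then show False using min[OF \<open>good c'\<close>] by simp
  qed
  have "reduced_colouring E c"
    by unfold_locales (use fin card2 proper colours down spare in blast)+
  then show ?thesis by blast
qed

section \<open>Connected graphs and the union over components\<close>

text \<open>If the reduced colouring uses colour 3 or 4, connectedness gives \<open>reach\<close>.
  Otherwise colours 1 and 2 form a bipartition, and \<open>r\<close> with its two neighbours absorbs
  the parity.\<close>

lemma connected_distinguishing:
  assumes fin: "finite E" and card2: "\<And>e. e \<in> E \<Longrightarrow> card e = 2"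
    and conn: "\<And>u v. u \<in> \<Union>E \<Longrightarrow> v \<in> \<Union>E \<Longrightarrow> (u, v) \<in> (adj_in E)\<^sup>*"
    and proper: "\<And>u v. {u, v} \<in> E \<Longrightarrow> c0 u \<noteq> c0 v"
    and colours: "\<And>v. v \<in> \<Union>E \<Longrightarrow> 1 \<le> c0 v \<and> c0 v \<le> (4::nat)"
    and r: "{r, s1} \<in> E" "{r, s2} \<in> E" "s1 \<noteq> s2"
  shows "\<exists>A B. distinguishing E A B"
proof -
  obtain c where "reduced_colouring E c"
    using reduced_colouring_exists[of E c0] fin card2 proper colours by blast
  then interpret reduced_colouring E c .
  show ?thesis
  proof (cases "\<exists>w\<in>\<Union>E. 3 \<le> c w")
    case True
    then show ?thesis using conn by (intro distinguishing_exists) blast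
  next
    case False
    have "(c u = 1) \<noteq> (c v = 1)" if e: "{u, v} \<in> E" for u v
    proof -
      have "u \<in> \<Union>E" "v \<in> \<Union>E" using edge_ends[OF e] .
      then have "c u = 1 \<or> c u = 2" "c v = 1 \<or> c v = 2"
        using False reduced_colouring.colours[OF \<open>reduced_colouring E c\<close>] by force+
      then show ?thesis using reduced_colouring.proper[OF \<open>reduced_colouring E c\<close> e] by auto
    qed
    from bipartite_distinguishing[of E "\<lambda>v. c v = 1", OF fin card2 conn this r] show ?thesis by blast
  qed
qed

text \<open>Components are treated separately. By \<open>nice\<close> each contains two edges
  sharing a vertex, which provide \<open>r\<close>, \<open>s1\<close> and \<open>s2\<close> for
  \<open>connected_distinguishing\<close>.\<close>

lemma four_colourable_distinguishing:
  assumes fin: "finite E" and card2: "\<And>e. e \<in> E \<Longrightarrow> card e = 2"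
    and proper: "\<And>u v. {u, v} \<in> E \<Longrightarrow> c u \<noteq> c v"
    and colours: "\<And>v. v \<in> \<Union>E \<Longrightarrow> 1 \<le> c v \<and> c v \<le> (4::nat)"
    and nice: "\<And>e. e \<in> E \<Longrightarrow> \<exists>f\<in>E. f \<noteq> e \<and> e \<inter> f \<noteq> {}"
  shows "\<exists>A B. distinguishing E A B"
proof -
  define comp where "comp v = (adj_in E)\<^sup>* `` {v}" for v
  define EK where "EK K = {e \<in> E. e \<subseteq> K}" for K
  have comp_eq: "comp v = comp u" if "v \<in> comp u" for u v
  proof -
    have "(u, v) \<in> (adj_in E)\<^sup>*" "(v, u) \<in> (adj_in E)\<^sup>*"
      using that adj_in_sym by (auto simp: comp_def)
    then show ?thesis by (auto simp: comp_def intro: rtrancl_trans)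
  qed
  have comp_sub: "e \<subseteq> comp v" if ev: "e \<in> E" "v \<in> e" for e v
  proof -
    obtain u where "e = {v, u}" using card2_obtain[OF card2[OF ev(1)] ev(2)] by blast
    then show ?thesis using ev by (auto simp: comp_def)
  qed
  have "\<exists>A B. distinguishing (EK K) A B" if K: "K \<in> comp ` \<Union>E" for K
  proof -
    from K obtain v e where v: "e \<in> E" "v \<in> e" "K = comp v" by blast
    obtain f where f: "f \<in> E" "f \<noteq> e" "e \<inter> f \<noteq> {}" using nice[OF v(1)] by blast
    then obtain r where r: "r \<in> e" "r \<in> f" by blast
    obtain s1 where s1: "e = {r, s1}" using card2_obtain[OF card2[OF v(1)] r(1)] by blast
    obtain s2 where s2: "f = {r, s2}" using card2_obtain[OF card2[OF f(1)] r(2)] by blast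
    have "r \<in> comp v" using comp_sub[OF v(1,2)] r by blast
    then have cr: "comp r = K" using comp_eq v by blast
    have sub: "e \<subseteq> K" "f \<subseteq> K" using comp_sub v(1) f(1) r cr by blast+
    have path: "(u, w) \<in> (adj_in (EK K))\<^sup>* \<and> w \<in> K" if "(u, w) \<in> (adj_in E)\<^sup>*" "u \<in> K" for u w
      using that
    proof (induction rule: rtrancl_induct)
      case base then show ?case by simp
    next
      case (step y z)
      have yK: "y \<in> K" and e: "{y, z} \<in> E" using step by auto
      have "comp y = K" using comp_eq yK v(3) by simp
      then have "{y, z} \<subseteq> K" using comp_sub[OF e, of y] by simp
      then have "(y, z) \<in> adj_in (EK K)" "z \<in> K" using e by (auto simp: EK_def)
      then show ?case using step by (blast intro: rtrancl_into_rtrancl)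
    qed
    show ?thesis
    proof (rule connected_distinguishing)
      show "finite (EK K)" using fin by (simp add: EK_def)
      show "card e = 2" if "e \<in> EK K" for e using that card2 by (simp add: EK_def)
      show "(u, w) \<in> (adj_in (EK K))\<^sup>*" if "u \<in> \<Union>(EK K)" "w \<in> \<Union>(EK K)" for u w
      proof -
        have uw: "u \<in> comp v" "w \<in> comp v" using that v(3) by (auto simp: EK_def)
        then have "w \<in> comp u" using comp_eq by blast
        then show ?thesis using path uw v(3) by (auto simp: comp_def)
      qed
      show "c u \<noteq> c w" if "{u, w} \<in> EK K" for u w using that proper by (simp add: EK_def)
      show "1 \<le> c w \<and> c w \<le> 4" if "w \<in> \<Union>(EK K)" for w using that colours by (auto simp: EK_def)
      show "{r, s1} \<in> EK K" "{r, s2} \<in> EK K" "s1 \<noteq> s2"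
        using sub s1 s2 v(1) f by (auto simp: EK_def)
    qed
  qed
  then obtain A B where AB: "\<And>K. K \<in> comp ` \<Union>E \<Longrightarrow> distinguishing (EK K) (A K) (B K)" by metis
  define UA where "UA = (\<Union>K\<in>comp ` \<Union>E. A K)"
  define UB where "UB = (\<Union>K\<in>comp ` \<Union>E. B K)"
  \<comment> \<open>An edge determines its component, so the degrees in the unions are those within
    the component of the vertex.\<close>
  have home: "K = comp v" if "K \<in> comp ` \<Union>E" "e \<in> EK K" "v \<in> e" for K e v
    using that comp_eq unfolding EK_def by blast
  have sub: "A K \<subseteq> EK K" "B K \<subseteq> EK K" "A K \<inter> B K = {}" if "K \<in> comp ` \<Union>E" for K
    using AB[OF that] by (auto simp: distinguishing_def)
  have deg: "deg UA v = deg (A (comp v)) v" "deg UB v = deg (B (comp v)) v" if "v \<in> \<Union>E" for v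
  proof -
    have K: "comp v \<in> comp ` \<Union>E" using that by blast
    have only: "K = comp v" if "K \<in> comp ` \<Union>E" "e \<in> A K \<or> e \<in> B K" "v \<in> e" for K e
      using home[of K e v] that sub[OF that(1)] by blast
    have "e \<in> UA \<longleftrightarrow> e \<in> A (comp v)" if ve: "v \<in> e" for e
    proof
      assume "e \<in> UA"
      then obtain K' where "K' \<in> comp ` \<Union>E" "e \<in> A K'" unfolding UA_def by (rule UN_E)
      then show "e \<in> A (comp v)" using only[of K' e] ve by simp
    next
      assume "e \<in> A (comp v)"
      with K show "e \<in> UA" unfolding UA_def by (rule UN_I)
    qed
    then show "deg UA v = deg (A (comp v)) v" by (rule deg_cong)
    have "e \<in> UB \<longleftrightarrow> e \<in> B (comp v)" if ve: "v \<in> e" for e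
    proof
      assume "e \<in> UB"
      then obtain K' where "K' \<in> comp ` \<Union>E" "e \<in> B K'" unfolding UB_def by (rule UN_E)
      then show "e \<in> B (comp v)" using only[of K' e] ve by simp
    next
      assume "e \<in> B (comp v)"
      with K show "e \<in> UB" unfolding UB_def by (rule UN_I)
    qed
    then show "deg UB v = deg (B (comp v)) v" by (rule deg_cong)
  qed
  have "deg UA u \<noteq> deg UA v \<or> deg UB u \<noteq> deg UB v" if e: "{u, v} \<in> E" for u v
  proof -
    have uv: "u \<in> \<Union>E" "v \<in> \<Union>E" using e by auto
    have s: "{u, v} \<subseteq> comp u" using comp_sub[OF e] by simp
    then have "comp v = comp u" using comp_eq by blast
    moreover have "{u, v} \<in> EK (comp u)" using e s by (simp add: EK_def)
    ultimately show ?thesis using AB[of "comp u"] uv by (auto simp: distinguishing_def deg)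
  qed
  moreover have "UA \<inter> UB = {}"
  proof -
    have False if "e \<in> UA" "e \<in> UB" for e
    proof -
      from that obtain K K' where K: "K \<in> comp ` \<Union>E" "e \<in> A K" "K' \<in> comp ` \<Union>E" "e \<in> B K'"
        by (auto simp: UA_def UB_def)
      then have e: "e \<in> EK K" "e \<in> EK K'" using sub by blast+
      then have "card e = 2" using card2 by (simp add: EK_def)
      then obtain v where "v \<in> e" by (metis card.empty equals0I zero_neq_numeral)
      then have "K = K'" using home K e by metis
      then show False using sub(3)[OF K(1)] K(2,4) by auto
    qed
    then show ?thesis by blast
  qed
  moreover have "EK K \<subseteq> E" for K by (simp add: EK_def)
  then have "UA \<subseteq> E" "UB \<subseteq> E"
    unfolding UA_def UB_def using sub(1,2) by (intro UN_least; meson order_trans)+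
  ultimately have "distinguishing E UA UB" by (simp add: distinguishing_def)
  then show ?thesis by blast
qed

section \<open>From edge sets to labellings\<close>

text \<open>After cancelling the smaller power of 2, one side is a power of 3 and hence odd, so no
  factor 2 remains on the other.\<close>

lemma pow2_pow3_eq_iff:
  fixes a b c d :: nat
  shows "(2::nat) ^ a * 3 ^ b = 2 ^ c * 3 ^ d \<longleftrightarrow> a = c \<and> b = d"
proof
  have aux: "a = c \<and> b = d" if le: "a \<le> c" and eq: "(2::nat) ^ a * 3 ^ b = 2 ^ c * 3 ^ d" for a b c d :: nat
  proof -
    have "(2::nat) ^ c = 2 ^ a * 2 ^ (c - a)" using le by (simp flip: power_add)
    then have *: "(3::nat) ^ b = 2 ^ (c - a) * 3 ^ d" using eq by simp
    have "odd ((3::nat) ^ b)" by simp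
    then have "c - a = 0" unfolding * by simp
    then show ?thesis using * le by simp
  qed
  show "(2::nat) ^ a * 3 ^ b = 2 ^ c * 3 ^ d \<Longrightarrow> a = c \<and> b = d"
    using aux[of a c b d] aux[of c a d b] by (cases "a \<le> c") auto
qed simp

lemma label_product_eq:
  assumes "finite (edges G)" "A \<subseteq> edges G" "B \<subseteq> edges G" "A \<inter> B = {}"
  shows "label_product G (\<lambda>e. if e \<in> A then 2 else if e \<in> B then 3 else 1) v = 2 ^ deg A v * 3 ^ deg B v"
proof -
  let ?S = "{e \<in> edges G. v \<in> e}" and ?l = "\<lambda>e. if e \<in> A then 2 else if e \<in> B then 3 else (1::nat)"
  let ?SA = "{e \<in> A. v \<in> e}" and ?SB = "{e \<in> B. v \<in> e}"
  have "finite A" "finite B" using assms(1-3) finite_subset by blast+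
  then have "finite ?SA" "finite ?SB" by simp_all
  have "prod ?l ?S = prod ?l (?SA \<union> ?SB)"
    using assms by (intro prod.mono_neutral_right) auto
  also have "\<dots> = prod ?l ?SA * prod ?l ?SB"
    using \<open>finite ?SA\<close> \<open>finite ?SB\<close> assms(4) by (intro prod.union_disjoint) auto
  also have "prod ?l ?SA = 2 ^ deg A v" by (simp add: deg_def)
  also have "prod ?l ?SB = (\<Prod>e\<in>?SB. 3)" using assms(4) by (intro prod.cong) auto
  also have "\<dots> = 3 ^ deg B v" by (simp add: deg_def)
  finally show ?thesis by (simp add: label_product_def)
qed

text \<open>The least number is attained, since an injective numbering of the vertices, shifted
  because colours start at 1, is a proper colouring.\<close>

lemma proper_colouring_chromatic_number:
  assumes "finite_simple_graph G"
  shows "\<exists>c. proper_colouring G (chromatic_number G) c"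
proof -
  have "finite (verts G)" using assms by (simp add: finite_simple_graph_def)
  then obtain h where h: "bij_betw h (verts G) {0..<card (verts G)}"
    using ex_bij_betw_finite_nat by blast
  have "h u \<noteq> h v" if e: "{u, v} \<in> edges G" for u v
  proof -
    have "{u, v} \<subseteq> verts G" "card {u, v} = 2" using assms e unfolding finite_simple_graph_def by blast+
    then have "u \<in> verts G" "v \<in> verts G" "u \<noteq> v" by auto
    then show ?thesis using bij_betw_imp_inj_on[OF h] by (auto dest: inj_onD)
  qed
  moreover have "(\<lambda>v. Suc (h v)) \<in> verts G \<rightarrow> {1..card (verts G)}"
    using bij_betwE[OF h] by (auto simp: Suc_le_eq)
  ultimately have "\<exists>c. proper_colouring G (card (verts G)) c"
    by (auto simp: proper_colouring_def)
  then show ?thesis unfolding chromatic_number_def by (rule LeastI)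
qed

text \<open>No walk leaves an edge that meets no other edge, so its two ends would form a component
  \<open>K2\<close>.\<close>

lemma adjacent_edge_exists:
  assumes G: "finite_simple_graph G"
    and nice: "\<not> (\<exists>C \<in> connected_components G. graph_isomorphic C (complete_graph 2))"
    and e: "e \<in> edges G"
  shows "\<exists>f\<in>edges G. f \<noteq> e \<and> e \<inter> f \<noteq> {}"
proof (rule ccontr)
  assume no: "\<not> ?thesis"
  have "card e = 2" "e \<subseteq> verts G" using G e by (auto simp: finite_simple_graph_def)
  then obtain u v where uv: "e = {u, v}" "u \<noteq> v" "u \<in> verts G" "v \<in> verts G" by (auto simp: card_2_iff)
  have closed: "y \<in> {u, v}" if "(u, y) \<in> (adj_rel G)\<^sup>*" for y
    using that
  proof (induction rule: rtrancl_induct)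
    case (step y z)
    then have "{y, z} \<in> edges G" by (simp add: adj_rel_def)
    moreover have "y \<in> e" using step.IH uv(1) by simp
    ultimately have "{y, z} = e" using no by (metis IntI empty_iff insertI1)
    then have "z \<in> e" by blast
    then show ?case using uv(1) by simp
  qed simp
  have "(u, v) \<in> adj_rel G" using e uv(1) by (simp add: adj_rel_def)
  then have comp: "{x \<in> verts G. (u, x) \<in> (adj_rel G)\<^sup>*} = {u, v}" 
    using closed uv(3,4) by blast
  have C: "induced_subgraph G {u, v} \<in> connected_components G"
    unfolding connected_components_def by (rule image_eqI[OF _ uv(3)]) (simp only: comp)
  define f where "f x = (if x = u then 0 else 1 :: nat)" for x
  have f: "f u = 0" "f v = 1" using uv(2) by (simp_all add: f_def)
  have "{..<2::nat} = f ` {u, v}" using f by auto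
  then have "bij_betw f {u, v} {..<2}" using uv(2) f by (simp add: bij_betw_def)
  \<comment> \<open>On two adjacent vertices adjacency is just inequality, as in
    \<open>complete_graph 2\<close>, so the bijection \<open>f\<close> preserves it.\<close>
  moreover have "{a, b} \<in> edges (induced_subgraph G {u, v}) \<longleftrightarrow> a \<noteq> b" if "a \<in> {u, v}" "b \<in> {u, v}" for a b
  proof (cases "a = b")
    case True
    have "{b, b} \<notin> edges G" using G by (auto simp: finite_simple_graph_def)
    then show ?thesis using True by (simp add: induced_subgraph_def)
  next
    case False
    then have "{a, b} = e" using that uv(1) by blast
    then show ?thesis using False e uv(1) by (simp add: induced_subgraph_def)
  qed
  moreover have "{f a, f b} \<in> edges (complete_graph 2) \<longleftrightarrow> a \<noteq> b" if "a \<in> {u, v}" "b \<in> {u, v}" for a b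
    using that f uv(2) by (elim insertE emptyE) (simp_all add: complete_graph_def)
  ultimately have "graph_isomorphic (induced_subgraph G {u, v}) (complete_graph 2)"
    unfolding graph_isomorphic_def
    by (intro exI[of _ f] conjI ballI) (simp_all add: induced_subgraph_def complete_graph_def)
  then show False using nice C by blast
qed

theorem theorem2p1:
  fixes G :: "'a ugraph"
  assumes "finite_simple_graph G"
    and "chromatic_number G = 4"
    and "\<not> (\<exists>C \<in> connected_components G. graph_isomorphic C (complete_graph 2))"
  shows "(\<exists>l. labelling G 3 l \<and> p_proper G l) \<and> chi_P G \<le> 3"
proof -
  have E: "e \<subseteq> verts G" "card e = 2" if "e \<in> edges G" for e
    using assms(1) that by (auto simp: finite_simple_graph_def)
  have "edges G \<subseteq> Pow (verts G)" using E by blast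
  then have fin: "finite (edges G)"
    using assms(1) by (auto simp: finite_simple_graph_def intro: finite_subset)
  obtain c where c: "proper_colouring G 4 c"
    using proper_colouring_chromatic_number[OF assms(1)] assms(2) by auto
  have "c u \<noteq> c v" if "{u, v} \<in> edges G" for u v
    using c that by (auto simp: proper_colouring_def)
  moreover have "1 \<le> c v \<and> c v \<le> 4" if "v \<in> \<Union>(edges G)" for v
    using c that E(1) by (fastforce simp: proper_colouring_def)
  ultimately obtain A B where "distinguishing (edges G) A B"
    using four_colourable_distinguishing[of "edges G" c] fin E(2) adjacent_edge_exists[OF assms(1,3)]
    by blast
  then have AB: "A \<subseteq> edges G" "B \<subseteq> edges G" "A \<inter> B = {}"
    "\<And>u v. {u, v} \<in> edges G \<Longrightarrow> deg A u \<noteq> deg A v \<or> deg B u \<noteq> deg B v"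
    by (auto simp: distinguishing_def)
  define l where "l = (\<lambda>e. if e \<in> A then 2 else if e \<in> B then 3 else (1::nat))"
  have "labelling G 3 l" by (auto simp: labelling_def l_def)
  moreover have "p_proper G l"
    unfolding p_proper_def l_def label_product_eq[OF fin AB(1-3)] pow2_pow3_eq_iff
    using AB(4) by blast
  ultimately have l: "\<exists>l. labelling G 3 l \<and> p_proper G l" by blast
  have "chi_P G \<le> enat 3" unfolding chi_P_def using l by (intro Inf_lower) auto
  then show ?thesis using l by (simp add: numeral_eq_enat)
qed

end
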